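(* Consider a feasible instance of 2-TSP with Vertex Requisitions (2-TSPVR) with $n\ge 2$ vertices, and let $q=q(\bar G)$ and the numbers $P_j^{k}$ ($j=1,\dots,q$, $k\in\{0,1\}$) and $P^{(k,l)}_{jj'}$ ($1\le j<j'\le q$, $k,l\in\{0,1\}$) be as defined in the context. Let (Q) be the problem of minimizing over $d\in\{0,1\}^{q}$ the function $$\sum_{j=1}^{q-1}\sum_{j'=j+1}^{q}\Big(P^{(0,0)}_{jj'}(1-d_j)(1-d_{j'})+P^{(0,1)}_{jj'}(1-d_j)d_{j'}+P^{(1,0)}_{jj'}d_j(1-d_{j'})+P^{(1,1)}_{jj'}d_jd_{j'}\Big)+\sum_{j=1}^{q}\big(P_j^0(1-d_j)+P_j^1d_j\big).$$ Let (M) be the mixed integer linear program of minimizing $$\sum_{j=1}^{q-1}\big(p_j^{(0)}+p_j^{(1)}\big)+\sum_{j=1}^{q}\big(P_j^0(1-d_j)+P_j^1d_j\big)$$ over $d\in\{0,1\}^q$ and real $p_j^{(0)},p_j^{(1)}\ge 0$, $j=1,\dots,q-1$, subject to, for $j=1,\dots,q-1$, $$p_j^{(0)}\ge\sum_{j'=j+1}^{q}P^{(0,0)}_{jj'}(1-d_j-d_{j'})+\sum_{j'=j+1}^{q}P^{(0,1)}_{jj'}(d_{j'}-d_j),$$ $$p_j^{(1)}\ge\sum_{j'=j+1}^{q}P^{(1,0)}_{jj'}(d_j-d_{j'})+\sum_{j'=j+1}^{q}P^{(1,1)}_{jj'}(d_j+d_{j'}-1).$$ Then (Q) and (M) are equivalent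 formulations of 2-TSPVR: the optimal values of (Q) and (M) are equal; if $(d,p)$ is an optimal solution of (M) then $d$ is an optimal solution of (Q); for every optimal solution $d$ of (Q) there is $p$ such that $(d,p)$ is an optimal solution of (M); and $d$ is an optimal solution of (Q) if and only if $f_d$ is an optimal solution of the 2-TSPVR instance. Moreover, (M) has $q\le\lfloor n/2\rfloor$ Boolean variables, $2q-2$ real variables (when $q\ge 1$) and $O(q)$ constraints.
   Context: 2-TSPVR. An instance consists of a set $X=\{x_1,\dots,x_n\}$ of vertices of a complete digraph with non-negative arc weights $\rho(x,y)$, $x\ne y$, and subsets (requisitions) $X^1,\dots,X^n\subseteq X$ with $1\le |X^i|\le 2$ for all $i$. $F$ is the set of bijections $f:\{1,\dots,n\}\to X$ with $f(i)\in X^i$ for all $i$; the instance is feasible if $F\neq\emptyset$. The cost of $f\in F$ is $\rho(f)=\sum_{i=1}^{n-1}\rho(f(i),f(i+1))+\rho(f(n),f(1))$, to be minimized over $F$. Indices are cyclic ($n+1:=1$). Bipartite graph. Let $X_n=\{1,\dots,n\}$ and let $\bar G=(X_n,X,\bar U)$ be the bipartite graph with edge set $\bar U=\{\{i,x\}: i\in X_n,\ x\in X^i\}$. Feasible solutions $f\in F$ correspond one-to-one to perfect matchings $\{\{i,f(i)\}: i\in X_n\}$ of $\bar G$. An edge is special if it belongs to all perfect matchings of $\bar G$; a vertex is special if it is incident with a special edge. For a feasible instance, let $\bar G'$ be the graph obtained from $\bar G$ by deleting all special vertices; $\bar G'$ is 2-regular, so its components are even cycles, numbered $1,\dots,q(\bar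 G)$. Each cycle $j$ has exactly two perfect matchings, denoted $w^{0,j}$ and $w^{1,j}$. Each vector $d\in\{0,1\}^{q(\bar G)}$ determines the feasible solution $f_d$ whose perfect matching consists of all special edges and the matchings $w^{d_j,j}$, $j=1,\dots,q(\bar G)$; $d\mapsto f_d$ is a bijection from $\{0,1\}^{q(\bar G)}$ onto $F$. Contacts and the numbers $P$. For each $i\in\{1,\dots,n\}$ consider the pair $(i,i+1)$ of vertices of $X_n$ (with $n+1:=1$). It is a contact inside cycle $j$ if both $i$ and $i+1$ lie on cycle $j$; a contact of cycle $j$ to a special edge if one of $i,i+1$ lies on cycle $j$ and the other is special; a contact between cycles $j\ne j'$ if one of $i,i+1$ lies on cycle $j$ and the other on cycle $j'$. The choice of matchings in the cycles containing $i$ and $i+1$ (together with the special edges) determines the vertices $f(i),f(i+1)$ and hence the $i$-th arc $(f(i),f(i+1))$ of the tour. $P_j^{k}$ is the sum of the weights of the arcs determined by all contacts inside cycle $j$ and all contacts of cycle $j$ to special edges when $w^{k,j}$ is chosen in cycle $j$. $P^{(k,l)}_{jj'}$ is the sum of the weights of the arcs determined by all contacts between cycles $j$ and $j'$ when $w^{k,j}$ is chosen in cycle $j$ and $w^{l,j'}$ in cycle $j'$. Empty sums are zero. *)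

theory Defs
  imports Complex_Main "HOL-Library.FuncSet"
begin

section \<open>Instances of 2-TSP with vertex requisitions\<close>

record 'a tspvr =
  num :: nat
  verts :: "'a set"
  req :: "nat \<Rightarrow> 'a set"
  wt :: "'a \<Rightarrow> 'a \<Rightarrow> real"

definition two_tspvr :: "'a tspvr \<Rightarrow> bool" where
  "two_tspvr I \<longleftrightarrow>
     finite (verts I) \<and> card (verts I) = num I \<and>
     (\<forall>x\<in>verts I. \<forall>y\<in>verts I. x \<noteq> y \<longrightarrow> wt I x y \<ge> 0) \<and>
     (\<forall>i\<in>{1..num I}. req I i \<subseteq> verts I \<and> 1 \<le> card (req I i) \<and> card (req I i) \<le> 2)"

definition solutions :: "'a tspvr \<Rightarrow> (nat \<Rightarrow> 'a) set" where
  "solutions I = {f \<in> (\<Pi>\<^sub>E i\<in>{1..num I}. req I i). bij_betw f {1..num I} (verts I)}"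

definition feasible :: "'a tspvr \<Rightarrow> bool" where
  "feasible I \<longleftrightarrow> solutions I \<noteq> {}"

definition tour_cost :: "'a tspvr \<Rightarrow> (nat \<Rightarrow> 'a) \<Rightarrow> real" where
  "tour_cost I f = (\<Sum>i=1..num I - 1. wt I (f i) (f (i + 1))) + wt I (f (num I)) (f 1)"

definition cyc_suc :: "nat \<Rightarrow> nat \<Rightarrow> nat" where
  "cyc_suc n i = (if i = n then 1 else i + 1)"


section \<open>Graphs\<close>

type_synonym 'v graph = "'v set \<times> 'v set set"

definition perfect_matching :: "'v graph \<Rightarrow> 'v set set \<Rightarrow> bool" where
  "perfect_matching G M \<longleftrightarrow> M \<subseteq> snd G \<and> (\<forall>v\<in>fst G. \<exists>!e. e \<in> M \<and> v \<in> e)"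

definition special_edges :: "'v graph \<Rightarrow> 'v set set" where
  "special_edges G = {e \<in> snd G. \<forall>M. perfect_matching G M \<longrightarrow> e \<in> M}"

definition special_vertices :: "'v graph \<Rightarrow> 'v set" where
  "special_vertices G = {v \<in> fst G. \<exists>e\<in>special_edges G. v \<in> e}"

definition delete_vertices :: "'v graph \<Rightarrow> 'v set \<Rightarrow> 'v graph" where
  "delete_vertices G S = (fst G - S, {e \<in> snd G. e \<inter> S = {}})"

definition connected_rel :: "'v graph \<Rightarrow> ('v \<times> 'v) set" where
  "connected_rel G = {(u, v). u \<in> fst G \<and> v \<in> fst G \<and> (u, v) \<in> {(a, b). {a, b} \<in> snd G}\<^sup>*}"

definition graph_components :: "'v graph \<Rightarrow> 'v graph set" where
  "graph_components G = (\<lambda>C. (C, {e \<in> snd G. e \<subseteq> C})) ` (fst G // connected_rel G)"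


section \<open>The bipartite graph of an instance\<close>

text \<open>The two colour classes are made disjoint by tagging: positions are \<^term>\<open>Inl i\<close>,
  vertices of the digraph are \<^term>\<open>Inr x\<close>.\<close>

definition bip_graph :: "'a tspvr \<Rightarrow> (nat + 'a) graph" where
  "bip_graph I = (Inl ` {1..num I} \<union> Inr ` verts I,
                  {{Inl i, Inr x} | i x. i \<in> {1..num I} \<and> x \<in> req I i})"

definition reduced_graph :: "'a tspvr \<Rightarrow> (nat + 'a) graph" where
  "reduced_graph I = delete_vertices (bip_graph I) (special_vertices (bip_graph I))"

definition num_cycles :: "'a tspvr \<Rightarrow> nat" where
  "num_cycles I = card (graph_components (reduced_graph I))"

text \<open>For a feasible instance the components of the reduced graph are even cycles.
  \<open>cyc\<close> is an arbitrary numbering of them, and \<open>w 0 j\<close>, \<open>w 1 j\<close> are the perfect matchings of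
  cycle \<open>j\<close> in an arbitrary order. That a cycle has no perfect matchings besides these two is a
  fact about the instance and not part of the definition.\<close>

definition cycle_labelling ::
  "'a tspvr \<Rightarrow> (nat \<Rightarrow> (nat + 'a) graph) \<Rightarrow> (nat \<Rightarrow> nat \<Rightarrow> (nat + 'a) set set) \<Rightarrow> bool" where
  "cycle_labelling I cyc w \<longleftrightarrow>
     bij_betw cyc {1..num_cycles I} (graph_components (reduced_graph I)) \<and>
     (\<forall>j\<in>{1..num_cycles I}.
        perfect_matching (cyc j) (w 0 j) \<and> perfect_matching (cyc j) (w 1 j) \<and> w 0 j \<noteq> w 1 j)"

definition partner :: "(nat + 'a) set set \<Rightarrow> nat \<Rightarrow> 'a" where
  "partner M i = (THE x. {Inl i, Inr x} \<in> M)"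

definition sol_of ::
  "'a tspvr \<Rightarrow> (nat \<Rightarrow> nat \<Rightarrow> (nat + 'a) set set) \<Rightarrow> (nat \<Rightarrow> nat) \<Rightarrow> (nat \<Rightarrow> 'a)" where
  "sol_of I w d = restrict
     (partner (special_edges (bip_graph I) \<union> (\<Union>j\<in>{1..num_cycles I}. w (d j) j))) {1..num I}"


section \<open>Contacts\<close>

text \<open>The contact \<open>(i, i+1)\<close> is identified with its index \<open>i\<close>.\<close>

definition inside_contacts :: "'a tspvr \<Rightarrow> (nat \<Rightarrow> (nat + 'a) graph) \<Rightarrow> nat \<Rightarrow> nat set" where
  "inside_contacts I cyc j =
     {i \<in> {1..num I}. Inl i \<in> fst (cyc j) \<and> Inl (cyc_suc (num I) i) \<in> fst (cyc j)}"

definition special_contacts :: "'a tspvr \<Rightarrow> (nat \<Rightarrow> (nat + 'a) graph) \<Rightarrow> nat \<Rightarrow> nat set" where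
  "special_contacts I cyc j = (let S = special_vertices (bip_graph I) in
     {i \<in> {1..num I}. Inl i \<in> fst (cyc j) \<and> Inl (cyc_suc (num I) i) \<in> S \<or>
                      Inl i \<in> S \<and> Inl (cyc_suc (num I) i) \<in> fst (cyc j)})"

definition between_contacts ::
  "'a tspvr \<Rightarrow> (nat \<Rightarrow> (nat + 'a) graph) \<Rightarrow> nat \<Rightarrow> nat \<Rightarrow> nat set" where
  "between_contacts I cyc j j' =
     {i \<in> {1..num I}. Inl i \<in> fst (cyc j) \<and> Inl (cyc_suc (num I) i) \<in> fst (cyc j') \<or>
                      Inl i \<in> fst (cyc j') \<and> Inl (cyc_suc (num I) i) \<in> fst (cyc j)}"

definition arc_weight :: "'a tspvr \<Rightarrow> (nat + 'a) set set \<Rightarrow> nat \<Rightarrow> real" where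
  "arc_weight I M i = wt I (partner M i) (partner M (cyc_suc (num I) i))"

text \<open>Upper indices come before lower ones:
  \<open>P_single I cyc w k j\<close> is \<open>P\<close> with upper index \<open>k\<close> and lower index \<open>j\<close>, and
  \<open>P_pair I cyc w k l j j'\<close> is \<open>P\<close> with upper index \<open>(k, l)\<close> and lower index \<open>j j'\<close>.\<close>

definition P_single ::
  "'a tspvr \<Rightarrow> (nat \<Rightarrow> (nat + 'a) graph) \<Rightarrow> (nat \<Rightarrow> nat \<Rightarrow> (nat + 'a) set set) \<Rightarrow>
   nat \<Rightarrow> nat \<Rightarrow> real" where
  "P_single I cyc w k j =
     (\<Sum>i\<in>inside_contacts I cyc j \<union> special_contacts I cyc j.
        arc_weight I (special_edges (bip_graph I) \<union> w k j) i)"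

definition P_pair ::
  "'a tspvr \<Rightarrow> (nat \<Rightarrow> (nat + 'a) graph) \<Rightarrow> (nat \<Rightarrow> nat \<Rightarrow> (nat + 'a) set set) \<Rightarrow>
   nat \<Rightarrow> nat \<Rightarrow> nat \<Rightarrow> nat \<Rightarrow> real" where
  "P_pair I cyc w k l j j' =
     (\<Sum>i\<in>between_contacts I cyc j j'.
        arc_weight I (special_edges (bip_graph I) \<union> w k j \<union> w l j') i)"


section \<open>Optimal values\<close>

definition optimal_value :: "('s \<Rightarrow> real) \<Rightarrow> ('s \<Rightarrow> bool) \<Rightarrow> real \<Rightarrow> bool" where
  "optimal_value g S v \<longleftrightarrow> (\<exists>x. is_arg_min g S x \<and> g x = v)"


section \<open>The quadratic problem (Q)\<close>

definition bool_vectors :: "nat \<Rightarrow> (nat \<Rightarrow> nat) set" where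
  "bool_vectors q = ({1..q} \<rightarrow>\<^sub>E {0, 1})"

definition Q_obj ::
  "nat \<Rightarrow> (nat \<Rightarrow> nat \<Rightarrow> real) \<Rightarrow> (nat \<Rightarrow> nat \<Rightarrow> nat \<Rightarrow> nat \<Rightarrow> real) \<Rightarrow> (nat \<Rightarrow> nat) \<Rightarrow> real" where
  "Q_obj q P PP d =
     (\<Sum>j=1..q-1. \<Sum>j'=j+1..q.
          PP 0 0 j j' * (1 - real (d j)) * (1 - real (d j'))
        + PP 0 1 j j' * (1 - real (d j)) * real (d j')
        + PP 1 0 j j' * real (d j) * (1 - real (d j'))
        + PP 1 1 j j' * real (d j) * real (d j'))
   + (\<Sum>j=1..q. P 0 j * (1 - real (d j)) + P 1 j * real (d j))"


section \<open>Mixed integer programs and the program (M)\<close>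

text \<open>A constraint \<open>(l, r)\<close> stands for \<open>l \<ge> r\<close>. Sign restrictions on real variables
  are constraints; the range \<open>{0, 1}\<close> of the Boolean variables is built into feasibility.\<close>

type_synonym ('b, 'r) mip_fun = "('b \<Rightarrow> nat) \<times> ('r \<Rightarrow> real) \<Rightarrow> real"

record ('b, 'r) mip =
  bool_vars :: "'b set"
  real_vars :: "'r set"
  objective :: "('b, 'r) mip_fun"
  constraints :: "(('b, 'r) mip_fun \<times> ('b, 'r) mip_fun) list"

definition mip_feasible :: "('b, 'r) mip \<Rightarrow> ('b \<Rightarrow> nat) \<times> ('r \<Rightarrow> real) \<Rightarrow> bool" where
  "mip_feasible M z \<longleftrightarrow>
     fst z \<in> (bool_vars M \<rightarrow>\<^sub>E {0, 1}) \<and> snd z \<in> (real_vars M \<rightarrow>\<^sub>E UNIV) \<and>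
     (\<forall>(l, r)\<in>set (constraints M). l z \<ge> r z)"

definition affine_fun :: "'b set \<Rightarrow> 'r set \<Rightarrow> ('b, 'r) mip_fun \<Rightarrow> bool" where
  "affine_fun B R g \<longleftrightarrow>
     (\<exists>a b c. \<forall>d p. g (d, p) = (\<Sum>i\<in>B. a i * real (d i)) + (\<Sum>i\<in>R. b i * p i) + c)"

definition mixed_integer_linear :: "('b, 'r) mip \<Rightarrow> bool" where
  "mixed_integer_linear M \<longleftrightarrow>
     finite (bool_vars M) \<and> finite (real_vars M) \<and>
     affine_fun (bool_vars M) (real_vars M) (objective M) \<and>
     (\<forall>(l, r)\<in>set (constraints M).
        affine_fun (bool_vars M) (real_vars M) l \<and> affine_fun (bool_vars M) (real_vars M) r)"

text \<open>The real variable with upper index \<open>(k)\<close> and lower index \<open>j\<close> is \<open>p (k, j)\<close>.\<close>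

definition M_prog ::
  "nat \<Rightarrow> (nat \<Rightarrow> nat \<Rightarrow> real) \<Rightarrow> (nat \<Rightarrow> nat \<Rightarrow> nat \<Rightarrow> nat \<Rightarrow> real) \<Rightarrow> (nat, nat \<times> nat) mip" where
  "M_prog q P PP =
     \<lparr> bool_vars = {1..q},
       real_vars = {0, 1} \<times> {1..q-1},
       objective = (\<lambda>(d, p).
           (\<Sum>j=1..q-1. p (0, j) + p (1, j))
         + (\<Sum>j=1..q. P 0 j * (1 - real (d j)) + P 1 j * real (d j))),
       constraints =
         concat (map (\<lambda>j.
           [ (\<lambda>(d, p). p (0, j),
              \<lambda>(d, p). (\<Sum>j'=j+1..q. PP 0 0 j j' * (1 - real (d j) - real (d j')))
                     + (\<Sum>j'=j+1..q. PP 0 1 j j' * (real (d j') - real (d j)))),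
             (\<lambda>(d, p). p (1, j),
              \<lambda>(d, p). (\<Sum>j'=j+1..q. PP 1 0 j j' * (real (d j) - real (d j')))
                     + (\<Sum>j'=j+1..q. PP 1 1 j j' * (real (d j) + real (d j') - 1))),
             (\<lambda>(d, p). p (0, j), \<lambda>_. 0),
             (\<lambda>(d, p). p (1, j), \<lambda>_. 0) ]) [1..<q]) \<rparr>"


section \<open>Every feasible instance has a cycle labelling\<close>

lemma perfect_matching_of_solution:
  assumes f: "f \<in> solutions I"
  shows "perfect_matching (bip_graph I) ((\<lambda>i. {Inl i, Inr (f i)}) ` {1..num I})"
proof -
  have b: "bij_betw f {1..num I} (verts I)" and r: "\<And>i. i \<in> {1..num I} \<Longrightarrow> f i \<in> req I i"
    using f by (auto simp: solutions_def)
  let ?M = "(\<lambda>i. {Inl i, Inr (f i)}) ` {1..num I}"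
  have "\<exists>!e. e \<in> ?M \<and> v \<in> e" if v: "v \<in> fst (bip_graph I)" for v
  proof -
    have "fst (bip_graph I) = Inl ` {1..num I} \<union> Inr ` f ` {1..num I}"
      using b by (simp add: bip_graph_def bij_betw_def)
    then consider i where "i \<in> {1..num I}" "v = Inl i" | i where "i \<in> {1..num I}" "v = Inr (f i)"
      using v by (auto simp del: atLeastAtMost_iff)
    then obtain i where i: "i \<in> {1..num I}" "v \<in> {Inl i, Inr (f i)}"
      by cases simp_all
    have eq: "i' = i" if i': "i' \<in> {1..num I}" "v \<in> {Inl i', Inr (f i')}" for i'
      using i' i inj_onD[OF bij_betw_imp_inj_on[OF b], of i' i] by auto
    show ?thesis
    proof (rule ex1I)
      show "{Inl i, Inr (f i)} \<in> ?M \<and> v \<in> {Inl i, Inr (f i)}"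
        using i by simp
      show "e = {Inl i, Inr (f i)}" if e: "e \<in> ?M \<and> v \<in> e" for e
      proof -
        obtain i' where "i' \<in> {1..num I}" "e = {Inl i', Inr (f i')}" "v \<in> e"
          using e by blast
        then show ?thesis using eq by simp
      qed
    qed
  qed
  moreover have "?M \<subseteq> snd (bip_graph I)"
    unfolding bip_graph_def snd_conv using r by blast
  ultimately show ?thesis
    by (simp add: perfect_matching_def)
qed

lemma perfect_matching_restrict:
  assumes I: "two_tspvr I"
    and pm: "perfect_matching (bip_graph I) M"
    and c: "c \<in> graph_components (reduced_graph I)"
  shows "perfect_matching c {e \<in> M. e \<subseteq> fst c}"
    and "\<And>v e. v \<in> fst c \<Longrightarrow> e \<in> M \<Longrightarrow> v \<in> e \<Longrightarrow> e \<subseteq> fst c"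
proof -
  let ?G = "bip_graph I" and ?H = "reduced_graph I"
  let ?S = "special_vertices ?G"
  obtain u where u: "u \<in> fst ?H"
    and cV: "fst c = connected_rel ?H `` {u}"
    and cE: "snd c = {e \<in> snd ?H. e \<subseteq> fst c}"
    using c by (auto simp: graph_components_def quotient_def)
  have H: "fst ?H = fst ?G - ?S" "snd ?H = {e \<in> snd ?G. e \<inter> ?S = {}}"
    by (simp_all add: reduced_graph_def delete_vertices_def)
  have cH: "v \<in> fst ?H" if "v \<in> fst c" for v
    using that cV by (auto simp: connected_rel_def)
  have unique: "\<exists>!e. e \<in> M \<and> v \<in> e" if "v \<in> fst ?G" for v
    using pm that by (auto simp: perfect_matching_def)
  have sub: "e \<subseteq> fst c \<and> e \<in> snd ?H" if v: "v \<in> fst c" and e: "e \<in> M" "v \<in> e" for v e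
  proof -
    have eG: "e \<in> snd ?G"
      using pm e by (auto simp: perfect_matching_def)
    then obtain i x where ix: "e = {Inl i, Inr x}" "i \<in> {1..num I}" "x \<in> req I i"
      by (auto simp: bip_graph_def)
    then have "x \<in> verts I"
      using I unfolding two_tspvr_def by blast
    then have eV: "e \<subseteq> fst ?G"
      using ix by (simp add: bip_graph_def)
    have noS: "e \<inter> ?S = {}"
    proof (rule ccontr)
      assume "e \<inter> ?S \<noteq> {}"
      then obtain s where s: "s \<in> e" "s \<in> ?S" by blast
      then obtain e' where e': "e' \<in> special_edges ?G" "s \<in> e'" and sG: "s \<in> fst ?G"
        by (auto simp: special_vertices_def)
      have "e' \<in> M"
        using pm e' by (auto simp: special_edges_def)
      then have "e' = e"
        using unique[OF sG] s e' e by blast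
      then have "v \<in> ?S"
        using e' e eV by (auto simp: special_vertices_def)
      then show False using cH[OF v] H by simp
    qed
    then have eH: "e \<in> snd ?H"
      using eG H by simp
    have "y \<in> fst c" if y: "y \<in> e" for y
    proof (cases "y = v")
      case False
      then have "e = {v, y}"
        using ix y e by auto
      moreover have "y \<in> fst ?H" using noS y H eV by auto
      ultimately show ?thesis
        using v cV eH by (auto simp: connected_rel_def intro: rtrancl_into_rtrancl)
    qed (use v in simp)
    then show ?thesis using eH by blast
  qed
  show "\<And>v e. v \<in> fst c \<Longrightarrow> e \<in> M \<Longrightarrow> v \<in> e \<Longrightarrow> e \<subseteq> fst c"
    using sub by blast
  have "\<exists>!e. e \<in> {e \<in> M. e \<subseteq> fst c} \<and> v \<in> e" if v: "v \<in> fst c" for v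
  proof -
    have "v \<in> fst ?G"
      using cH[OF v] H by simp
    then have "\<exists>!e. e \<in> M \<and> v \<in> e"
      by (rule unique)
    moreover have "e \<in> M \<and> v \<in> e \<longleftrightarrow> e \<in> {e \<in> M. e \<subseteq> fst c} \<and> v \<in> e" for e
      using sub[OF v] by blast
    ultimately show ?thesis by simp
  qed
  moreover have "e \<in> snd c" if e: "e \<in> M" "e \<subseteq> fst c" for e
  proof -
    have "e \<noteq> {}"
      using pm e by (auto simp: perfect_matching_def bip_graph_def)
    then show ?thesis using sub e cE by blast
  qed
  ultimately show "perfect_matching c {e \<in> M. e \<subseteq> fst c}"
    by (auto simp: perfect_matching_def)
qed

lemma cycle_labelling_exists:
  assumes I: "two_tspvr I" and feas: "feasible I"
  shows "\<exists>cyc w. cycle_labelling I cyc w"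
proof -
  let ?G = "bip_graph I" and ?H = "reduced_graph I"
  obtain M where M: "perfect_matching ?G M"
    using feas perfect_matching_of_solution by (auto simp: feasible_def)
  have H: "fst ?H = fst ?G - special_vertices ?G"
    by (simp add: reduced_graph_def delete_vertices_def)
  have "finite (fst ?H)"
    using I by (simp add: H bip_graph_def two_tspvr_def)
  then have "finite (graph_components ?H)"
    by (auto simp: graph_components_def quotient_def)
  then obtain cyc where cyc: "bij_betw cyc {1..num_cycles I} (graph_components ?H)"
    using ex_bij_betw_nat_finite_1 by (auto simp: num_cycles_def)
  have "\<exists>m m'. perfect_matching c m \<and> perfect_matching c m' \<and> m \<noteq> m'"
    if c: "c \<in> graph_components ?H" for c
  proof -
    obtain v where v: "v \<in> fst ?H" "v \<in> fst c"
      using c by (auto simp: graph_components_def quotient_def connected_rel_def)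
    obtain e where e: "e \<in> M" "v \<in> e"
      using M v H by (auto simp: perfect_matching_def)
    have "e \<notin> special_edges ?G"
      using v e H by (auto simp: special_vertices_def)
    then obtain M' where M': "perfect_matching ?G M'" "e \<notin> M'"
      using M e by (auto simp: special_edges_def perfect_matching_def)
    have "e \<subseteq> fst c"
      using perfect_matching_restrict(2)[OF I M c] v e by blast
    then have "{e \<in> M. e \<subseteq> fst c} \<noteq> {e \<in> M'. e \<subseteq> fst c}"
      using e M' by blast
    then show ?thesis
      using perfect_matching_restrict(1)[OF I _ c] M M' by blast
  qed
  then obtain m m' where m: "\<And>c. c \<in> graph_components ?H \<Longrightarrow>
      perfect_matching c (m c) \<and> perfect_matching c (m' c) \<and> m c \<noteq> m' c"
    by metis
  have "cycle_labelling I cyc (\<lambda>k j. if k = 0 then m (cyc j) else m' (cyc j))"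
    unfolding cycle_labelling_def using cyc m[OF bij_betwE[OF cyc, rule_format]] by simp
  then show ?thesis by blast
qed

end

theory Submission
  imports Defs
begin

text \<open>Two distinct perfect matchings of a component of the reduced graph differ at every position,
  and a position has at most two requisitions, so a component has exactly two perfect matchings
  and contains at least two positions. A feasible solution is therefore the same as a choice of one
  matching in each cycle. Sorting the arcs of a tour by the cycles in which their ends are matched
  shows that its cost is the objective of (Q) plus the constant contributed by the contacts between
  special positions. For fixed \<open>d\<close> the cheapest \<open>p\<close> in (M) gives the variable with upper index
  \<open>d j\<close> and lower index \<open>j\<close> the quadratic cost of row \<open>j\<close>, and all other variables the value 0.\<close>

section \<open>Perfect matchings and components\<close>

text \<open>A labelling only names connected components and two different perfect matchings in each,
  so the facts about even cycles are recovered from two sources: connectedness, used as the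
  principle that a vertex set closed under the edges of a component is empty or everything, and the
  bound 2 on requisitions. The obstacle is an edge that leaves the set of positions where two
  matchings differ. It is excluded by a third matching, which exists because every special edge was
  deleted together with its ends. Nonnegativity of the pair coefficients is what makes (M) exact.
  With negative ones a row cost below 0 could not be matched by variables \<open>p \<ge> 0\<close>,
  and the right-hand side of the inactive constraint could become positive. (Q) and (M) agree in
  value, whereas (Q) and the tour cost agree only up to a constant, so for the tours it is the
  minimizers that are compared.\<close>

definition bipartite :: "(nat + 'a) graph \<Rightarrow> bool" where
  "bipartite G \<longleftrightarrow> (\<forall>e\<in>snd G. \<exists>i x. e = {Inl i, Inr x} \<and> Inl i \<in> fst G \<and> Inr x \<in> fst G)"

lemma bipartite_edgeE:
  assumes "bipartite G" "perfect_matching G m" "e \<in> m"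
  obtains i x where "e = {Inl i, Inr x}" "Inl i \<in> fst G" "Inr x \<in> fst G"
proof -
  have "e \<in> snd G"
    using assms(2,3) by (auto simp: perfect_matching_def)
  then show ?thesis
    using assms(1) that by (auto simp: bipartite_def)
qed

lemma perfect_matching_ex1:
  assumes "perfect_matching G m" "v \<in> fst G"
  shows "\<exists>!e. e \<in> m \<and> v \<in> e"
  using assms by (simp add: perfect_matching_def)

text \<open>This makes the definite description in \<open>partner\<close> usable: the unique edge of
  \<open>m\<close> at position \<open>i\<close> has exactly one other end. It is stated for any
  \<open>bipartite\<close> graph because it serves both the whole graph and single
  components.\<close>

lemma partner_eq_iff:
  assumes G: "bipartite G" and m: "perfect_matching G m" and i: "Inl i \<in> fst G"
  shows "{Inl i, Inr x} \<in> m \<longleftrightarrow> x = partner m i"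
proof -
  obtain e where e: "e \<in> m" "Inl i \<in> e" and uniq: "\<And>e'. e' \<in> m \<Longrightarrow> Inl i \<in> e' \<Longrightarrow> e' = e"
    using perfect_matching_ex1[OF m i] by blast
  obtain y where y: "e = {Inl i, Inr y}"
    using bipartite_edgeE[OF G m e(1)] e(2) by auto
  have "{Inl i, Inr x'} \<in> m \<longleftrightarrow> x' = y" for x'
    using uniq[of "{Inl i, Inr x'}"] e(1) by (auto simp: y doubleton_eq_iff)
  then show ?thesis by (simp add: partner_def)
qed

text \<open>A matching is thus determined by its partners, so different matchings must have
  different partners at some position.\<close>

lemma perfect_matching_eq_image:
  assumes G: "bipartite G" and m: "perfect_matching G m"
  shows "m = (\<lambda>i. {Inl i, Inr (partner m i)}) ` {i. Inl i \<in> fst G}"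
proof (intro set_eqI iffI)
  fix e assume e: "e \<in> m"
  obtain i x where ix: "e = {Inl i, Inr x}" "Inl i \<in> fst G"
    using bipartite_edgeE[OF G m e] .
  then have "x = partner m i"
    using partner_eq_iff[OF G m ix(2)] e by simp
  then show "e \<in> (\<lambda>i. {Inl i, Inr (partner m i)}) ` {i. Inl i \<in> fst G}"
    using ix by simp
qed (use partner_eq_iff[OF G m] in auto)

lemma perfect_matching_bij_betw:
  assumes G: "bipartite G" and m: "perfect_matching G m"
  shows "bij_betw (partner m) {i. Inl i \<in> fst G} {x. Inr x \<in> fst G}"
proof (rule bij_betw_imageI)
  have edge: "{Inl i, Inr (partner m i)} \<in> m \<and> Inr (partner m i) \<in> fst G" if i: "Inl i \<in> fst G" for i
  proof -
    have e: "{Inl i, Inr (partner m i)} \<in> m"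
      using partner_eq_iff[OF G m i] by simp
    then show ?thesis
      using bipartite_edgeE[OF G m e] by (auto simp: doubleton_eq_iff)
  qed
  show "inj_on (partner m) {i. Inl i \<in> fst G}"
  proof (rule inj_onI)
    fix i i' assume i: "i \<in> {i. Inl i \<in> fst G}" "i' \<in> {i. Inl i \<in> fst G}" "partner m i = partner m i'"
    let ?x = "partner m i"
    have e: "{Inl i, Inr ?x} \<in> m" "{Inl i', Inr ?x} \<in> m" "Inr ?x \<in> fst G"
      using i(1,2) edge[of i] edge[of i'] unfolding i(3) by simp_all
    then have "{Inl i, Inr ?x} = {Inl i', Inr ?x}"
      using perfect_matching_ex1[OF m e(3)] by (metis insertCI)
    then show "i = i'" by (auto simp: doubleton_eq_iff)
  qed
  show "partner m ` {i. Inl i \<in> fst G} = {x. Inr x \<in> fst G}"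
  proof (intro set_eqI iffI)
    fix x assume "x \<in> {x. Inr x \<in> fst G}"
    then obtain e where e: "e \<in> m" "Inr x \<in> e"
      using perfect_matching_ex1[OF m] by blast
    then show "x \<in> partner m ` {i. Inl i \<in> fst G}"
      using perfect_matching_eq_image[OF G m] by auto
  qed (use edge in auto)
qed

lemma partner_cong:
  assumes "\<And>x. {Inl i, Inr x} \<in> M \<longleftrightarrow> {Inl i, Inr x} \<in> M'"
  shows "partner M i = partner M' i"
  using assms by (simp add: partner_def)

section \<open>Connected components as equivalence classes\<close>

lemma equiv_connected_rel: "equiv (fst G) (connected_rel G)"
proof (rule equivI)
  show "connected_rel G \<subseteq> fst G \<times> fst G" "refl_on (fst G) (connected_rel G)"
    by (auto simp: connected_rel_def refl_on_def)
  have "sym ({(a, b). {a, b} \<in> snd G}\<^sup>*)"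
    by (rule sym_rtrancl) (auto simp: sym_def insert_commute)
  then show "sym (connected_rel G)"
    by (auto simp: connected_rel_def intro!: symI dest: symD)
  show "trans (connected_rel G)"
    by (auto simp: connected_rel_def trans_def)
qed

lemma component_quotient:
  assumes "c \<in> graph_components G"
  shows "fst c \<in> fst G // connected_rel G" "snd c = {e \<in> snd G. e \<subseteq> fst c}"
  using assms unfolding graph_components_def by fastforce+

lemma component_disjoint:
  assumes "c \<in> graph_components G" "c' \<in> graph_components G" "v \<in> fst c" "v \<in> fst c'"
  shows "c = c'"
proof (rule prod_eqI)
  show "fst c = fst c'"
    using quotient_disj[OF equiv_connected_rel component_quotient(1)[OF assms(1)]
        component_quotient(1)[OF assms(2)]] assms(3,4) by blast
  then show "snd c = snd c'"
    by (simp add: component_quotient(2)[OF assms(1)] component_quotient(2)[OF assms(2)])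
qed

lemma component_cover:
  assumes "v \<in> fst G"
  shows "\<exists>c\<in>graph_components G. v \<in> fst c"
proof -
  obtain C where "C \<in> fst G // connected_rel G" "v \<in> C"
    using assms Union_quotient[OF equiv_connected_rel[of G]] by blast
  then show ?thesis
    unfolding graph_components_def by (intro bexI imageI) auto
qed

lemma component_vertices_subset:
  assumes "c \<in> graph_components G"
  shows "fst c \<subseteq> fst G"
  using Union_upper[OF component_quotient(1)[OF assms]]
  by (simp add: Union_quotient[OF equiv_connected_rel])

lemma component_nonempty:
  assumes "c \<in> graph_components G"
  shows "fst c \<noteq> {}"
  by (rule in_quotient_imp_non_empty[OF equiv_connected_rel component_quotient(1)[OF assms]])

text \<open>The principle by which connectedness is exploited: a set that meets a component and is
  closed under its edges contains the component.\<close>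

lemma component_connected:
  assumes c: "c \<in> graph_components G" and wf: "\<And>e. e \<in> snd G \<Longrightarrow> e \<subseteq> fst G"
    and v: "v \<in> fst c" "v \<in> S"
    and closed: "\<And>a b. {a, b} \<in> snd c \<Longrightarrow> a \<in> S \<Longrightarrow> b \<in> S"
  shows "fst c \<subseteq> S"
proof
  fix u assume u: "u \<in> fst c"
  note C = component_quotient(1)[OF c]
  have "(v, u) \<in> connected_rel G"
    using quotient_eq_iff[OF equiv_connected_rel C C v(1) u] by simp
  then have "(v, u) \<in> {(a, b). {a, b} \<in> snd G}\<^sup>*"
    by (simp add: connected_rel_def)
  \<comment> \<open>The path runs through edges of \<open>G\<close>, but \<open>closed\<close>
    speaks of edges of \<open>c\<close>. Carrying membership in \<open>fst c\<close> along the path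
    turns every step into an edge of \<open>c\<close>.\<close>
  then have "u \<in> fst c \<and> u \<in> S"
  proof (induction rule: rtrancl_induct)
    case (step a b)
    have ab: "{a, b} \<in> snd G" "a \<in> fst c" "a \<in> S"
      using step by auto
    have "(a, b) \<in> connected_rel G"
      using ab(1) wf[OF ab(1)] by (simp add: connected_rel_def r_into_rtrancl)
    then have b: "b \<in> fst c"
      using in_quotient_imp_closed[OF equiv_connected_rel C ab(2)] by simp
    then have "{a, b} \<in> snd c"
      using ab by (simp add: component_quotient(2)[OF c])
    then show ?case using closed ab b by blast
  qed (use v in simp)
  then show "u \<in> S" by simp
qed

section \<open>The graph of an instance and the components of its reduced graph\<close>

lemma bip_graph_bipartite:
  assumes "two_tspvr I"
  shows "bipartite (bip_graph I)"
  unfolding bipartite_def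
proof
  fix e assume "e \<in> snd (bip_graph I)"
  then obtain i x where ix: "e = {Inl i, Inr x}" "i \<in> {1..num I}" "x \<in> req I i"
    by (auto simp: bip_graph_def)
  then have "x \<in> verts I"
    using assms unfolding two_tspvr_def by blast
  then show "\<exists>i x. e = {Inl i, Inr x} \<and> Inl i \<in> fst (bip_graph I) \<and> Inr x \<in> fst (bip_graph I)"
    using ix by (intro exI[of _ i] exI[of _ x]) (simp add: bip_graph_def)
qed

lemma bip_graph_edge_iff:
  "{Inl i, Inr x} \<in> snd (bip_graph I) \<longleftrightarrow> i \<in> {1..num I} \<and> x \<in> req I i"
  by (auto simp: bip_graph_def doubleton_eq_iff)

lemma reduced_graph_simps:
  "fst (reduced_graph I) = fst (bip_graph I) - special_vertices (bip_graph I)"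
  "snd (reduced_graph I) = {e \<in> snd (bip_graph I). e \<inter> special_vertices (bip_graph I) = {}}"
  by (simp_all add: reduced_graph_def delete_vertices_def)

lemma reduced_graph_edge_subset:
  assumes "two_tspvr I" "e \<in> snd (reduced_graph I)"
  shows "e \<subseteq> fst (reduced_graph I)"
  using bip_graph_bipartite[OF assms(1)] assms(2)
  by (fastforce simp: bipartite_def reduced_graph_simps)

lemma component_edge_iff:
  assumes "c \<in> graph_components (reduced_graph I)"
  shows "{Inl i, Inr x} \<in> snd c \<longleftrightarrow>
    i \<in> {1..num I} \<and> x \<in> req I i \<and> Inl i \<in> fst c \<and> Inr x \<in> fst c"
  using component_vertices_subset[OF assms]
  by (auto simp: component_quotient(2)[OF assms] reduced_graph_simps bip_graph_edge_iff)

lemma component_bipartite: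
  assumes "two_tspvr I" and c: "c \<in> graph_components (reduced_graph I)"
  shows "bipartite c"
  using bip_graph_bipartite[OF assms(1)]
  by (fastforce simp: bipartite_def component_quotient(2)[OF c] reduced_graph_simps)

text \<open>The bound 2 on requisitions enters here: besides \<open>x\<close> only one further
  choice remains at a position.\<close>

lemma req_pigeonhole:
  assumes "two_tspvr I" "i \<in> {1..num I}" "x \<in> req I i" "y \<in> req I i" "z \<in> req I i" "x \<noteq> y" "x \<noteq> z"
  shows "y = z"
proof (rule ccontr)
  assume "y \<noteq> z"
  then have "card {x, y, z} = 3" using assms by simp
  moreover have "req I i \<subseteq> verts I" "finite (verts I)" "card (req I i) \<le> 2"
    using assms(1,2) by (simp_all add: two_tspvr_def)
  then have "finite (req I i)" "card (req I i) \<le> 2"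
    by (auto intro: finite_subset)
  ultimately show False
    using card_mono[of "req I i" "{x, y, z}"] assms by auto
qed

text \<open>Let \<open>D\<close> be the set of positions at which two perfect matchings of a component differ. Both
  match \<open>D\<close> with the same set \<open>Y\<close>, and the two requisitions of a position in \<open>D\<close> lie in \<open>Y\<close>.
  Hence every perfect matching maps \<open>D\<close> onto \<open>Y\<close>, so an edge from \<open>Y\<close> to a position outside \<open>D\<close>
  could not occur in any perfect matching, although no edge at its position is special. By
  connectedness \<open>D\<close> is empty or everything.\<close>

lemma component_matchings_differ_everywhere:
  assumes I: "two_tspvr I" and c: "c \<in> graph_components (reduced_graph I)"
    and m: "perfect_matching c m" and m': "perfect_matching c m'" and ne: "m \<noteq> m'"
    and i: "Inl i \<in> fst c"
  shows "partner m i \<noteq> partner m' i"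
proof -
  let ?A = "{i. Inl i \<in> fst c}" and ?X = "{x. Inr x \<in> fst c}"
  note bip = component_bipartite[OF I c]
  note edge_iff = component_edge_iff[OF c]
  have A: "?A \<subseteq> {1..num I}"
    using component_vertices_subset[OF c] by (auto simp: reduced_graph_simps bip_graph_def)
  have bij: "bij_betw (partner m) ?A ?X" "bij_betw (partner m') ?A ?X"
    using perfect_matching_bij_betw[OF bip] m m' by auto
  have req: "partner n i \<in> req I i" if "perfect_matching c n" "i \<in> ?A" for n i
  proof -
    have "{Inl i, Inr (partner n i)} \<in> n"
      using partner_eq_iff[OF bip that(1)] that by simp
    then have "{Inl i, Inr (partner n i)} \<in> snd c"
      using that by (auto simp: perfect_matching_def)
    then show ?thesis using edge_iff by simp
  qed
  define D where "D = {i \<in> ?A. partner m i \<noteq> partner m' i}"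
  define Y where "Y = partner m ` D"
  have D: "D \<subseteq> ?A" by (auto simp: D_def)
  have "finite D"
    using A D finite_subset by (metis finite_atLeastAtMost)
  \<comment> \<open>Off \<open>D\<close> the two matchings agree. As both are bijections from
    \<open>?A\<close> to \<open>?X\<close>, each maps \<open>D\<close> onto the complement of the
    same set.\<close>
  have Y': "Y = partner m' ` D"
  proof -
    have "partner m ` (?A - D) = partner m' ` (?A - D)"
      by (rule image_cong) (auto simp: D_def)
    moreover have "partner n ` D = ?X - partner n ` (?A - D)" if "bij_betw (partner n) ?A ?X" for n
      using that D bij_betw_imp_inj_on[OF that]
      by (auto simp: bij_betw_def inj_on_image_set_diff[of _ ?A] Diff_Diff_Int)
    ultimately show ?thesis using bij by (simp add: Y_def)
  qed
  have fwd: "x \<in> Y" if "i \<in> D" "x \<in> req I i" for i x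
  proof -
    have iA: "i \<in> ?A" and ne: "partner m i \<noteq> partner m' i"
      using that by (auto simp: D_def)
    have iP: "i \<in> {1..num I}" using iA A by blast
    have "x = partner m i \<or> x = partner m' i"
      using req_pigeonhole[OF I iP req[OF m iA] that(2) req[OF m' iA]] ne by blast
    then show ?thesis
      using that(1) Y' unfolding Y_def by blast
  qed
  have bwd: "i \<in> D" if iA: "i \<in> ?A" and x: "x \<in> req I i" "x \<in> Y" for i x
  proof (rule ccontr)
    assume nD: "i \<notin> D"
    have iP: "i \<in> {1..num I}" using iA A by blast
    have "partner m i \<notin> Y"
      using nD iA D bij_betw_imp_inj_on[OF bij(1)] by (auto simp: Y_def dest: inj_onD)
    then have xm: "x \<noteq> partner m i" using x by blast
    let ?e = "{Inl i, Inr (partner m i)}"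
    have "Inl i \<in> fst (bip_graph I) - special_vertices (bip_graph I)"
      using iA component_vertices_subset[OF c] by (auto simp: reduced_graph_simps)
    then have "?e \<notin> special_edges (bip_graph I)"
      by (auto simp: special_vertices_def)
    moreover have "?e \<in> snd (bip_graph I)"
      using iA A req[OF m iA] by (auto simp: bip_graph_edge_iff)
    \<comment> \<open>Being special refers to the whole graph, so the matching that avoids
      \<open>?e\<close> lives there and must be restricted to \<open>c\<close>. At \<open>i\<close>
      only \<open>x\<close> is then left for it.\<close>
    ultimately obtain M where M: "perfect_matching (bip_graph I) M" "?e \<notin> M"
      by (auto simp: special_edges_def)
    define n where "n = {e \<in> M. e \<subseteq> fst c}"
    have n: "perfect_matching c n"
      unfolding n_def by (rule perfect_matching_restrict(1)[OF I M(1) c])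
    have "?e \<notin> n" using M(2) by (simp add: n_def)
    then have "partner n i \<noteq> partner m i"
      using partner_eq_iff[OF bip n] iA by auto
    then have px: "partner n i = x"
      using req_pigeonhole[OF I iP req[OF m iA] req[OF n iA] x(1)] xm by metis
    have inj: "inj_on (partner n) ?A" "inj_on (partner m) ?A"
      using perfect_matching_bij_betw[OF bip n] bij(1) by (auto simp: bij_betw_def)
    \<comment> \<open>Counting: \<open>partner n\<close> is injective on \<open>D\<close> and maps
      it into \<open>Y\<close>, which has as many elements as \<open>D\<close>. So \<open>x\<close>
      is already the partner of a position in \<open>D\<close> and cannot also be that of
      \<open>i\<close>.\<close>
    have "partner n ` D \<subseteq> Y"
      using fwd req[OF n] D by blast
    moreover have "card (partner n ` D) = card Y"
      unfolding Y_def using inj D by (simp add: card_image inj_on_subset)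
    moreover have "finite Y"
      unfolding Y_def using \<open>finite D\<close> by simp
    ultimately have "partner n ` D = Y"
      by (simp add: card_subset_eq)
    then obtain i' where "i' \<in> D" "partner n i' = partner n i"
      using x px by auto
    then show False
      using nD iA D inj_onD[OF inj(1), of i' i] by blast
  qed
  obtain i0 where i0: "i0 \<in> D"
  proof -
    have "D \<noteq> {}"
    proof
      assume "D = {}"
      then have "partner m i = partner m' i" if "i \<in> ?A" for i
        using that by (auto simp: D_def)
      then have "(\<lambda>i. {Inl i, Inr (partner m i)}) ` ?A = (\<lambda>i. {Inl i, Inr (partner m' i)}) ` ?A"
        by (intro image_cong) auto
      then show False
        using perfect_matching_eq_image[OF bip m] perfect_matching_eq_image[OF bip m'] ne by simp
    qed
    then show ?thesis using that by blast
  qed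
  have "fst c \<subseteq> Inl ` D \<union> Inr ` Y"
  proof (rule component_connected[OF c])
    show "e \<subseteq> fst (reduced_graph I)" if "e \<in> snd (reduced_graph I)" for e
      by (rule reduced_graph_edge_subset[OF I that])
    show "Inl i0 \<in> fst c" "Inl i0 \<in> Inl ` D \<union> Inr ` Y"
      using i0 D by auto
    fix a b assume ab: "{a, b} \<in> snd c" and a: "a \<in> Inl ` D \<union> Inr ` Y"
    then obtain i x where ix: "{a, b} = {Inl i, Inr x}"
      using bip unfolding bipartite_def by blast
    then have "i \<in> ?A" "x \<in> req I i"
      using ab edge_iff by auto
    then have "i \<in> D \<longleftrightarrow> x \<in> Y" using fwd bwd by blast
    then show "b \<in> Inl ` D \<union> Inr ` Y"
      using a ix by (auto simp: doubleton_eq_iff)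
  qed
  then show ?thesis
    using i by (auto simp: D_def)
qed

text \<open>A vertex of the component may belong to the other colour class; its matching edge then
  leads to a position.\<close>

lemma component_has_position:
  assumes I: "two_tspvr I" and c: "c \<in> graph_components (reduced_graph I)" and m: "perfect_matching c m"
  shows "\<exists>i. Inl i \<in> fst c"
proof -
  obtain v where "v \<in> fst c"
    using component_nonempty[OF c] by blast
  then obtain e where "e \<in> m"
    using m unfolding perfect_matching_def by blast
  then show ?thesis
    using perfect_matching_eq_image[OF component_bipartite[OF I c] m] by blast
qed

lemma component_partner_in_req:
  assumes I: "two_tspvr I" and c: "c \<in> graph_components (reduced_graph I)" and m: "perfect_matching c m"
    and i: "Inl i \<in> fst c"
  shows "i \<in> {1..num I}" "partner m i \<in> req I i" "Inr (partner m i) \<in> fst c"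
proof -
  have "{Inl i, Inr (partner m i)} \<in> m"
    using partner_eq_iff[OF component_bipartite[OF I c] m i] by simp
  then have "{Inl i, Inr (partner m i)} \<in> snd c"
    using m by (auto simp: perfect_matching_def)
  then show "i \<in> {1..num I}" "partner m i \<in> req I i" "Inr (partner m i) \<in> fst c"
    by (auto simp: component_edge_iff[OF c])
qed

text \<open>One position suffices: three pairwise different matchings would give it three different
  partners.\<close>

lemma component_two_matchings:
  assumes I: "two_tspvr I" and c: "c \<in> graph_components (reduced_graph I)"
    and m: "perfect_matching c m" "perfect_matching c m'" "m \<noteq> m'"
    and n: "perfect_matching c n"
  shows "n = m \<or> n = m'"
proof (rule ccontr)
  assume ne: "\<not> (n = m \<or> n = m')"
  obtain i where i: "Inl i \<in> fst c"
    using component_has_position[OF I c n] by blast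
  note differ = component_matchings_differ_everywhere[OF I c _ _ _ i]
  note req = component_partner_in_req[OF I c _ i]
  show False
    using req_pigeonhole[OF I req(1)[OF n] req(2)[OF n] req(2)[OF m(1)] req(2)[OF m(2)]]
      differ[OF n m(1)] differ[OF n m(2)] differ[OF m] ne by blast
qed

text \<open>The vertex that \<open>m'\<close> assigns to \<open>i\<close> is assigned by
  \<open>m\<close> to some position too, and not to \<open>i\<close>, where the matchings
  differ.\<close>

lemma component_two_positions:
  assumes I: "two_tspvr I" and c: "c \<in> graph_components (reduced_graph I)"
    and m: "perfect_matching c m" "perfect_matching c m'" "m \<noteq> m'"
  shows "card {i. Inl i \<in> fst c} \<ge> 2"
proof -
  let ?A = "{i. Inl i \<in> fst c}"
  note bip = component_bipartite[OF I c]
  obtain i where i: "Inl i \<in> fst c"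
    using component_has_position[OF I c m(1)] by blast
  have "partner m' i \<in> partner m ` ?A"
    using perfect_matching_bij_betw[OF bip m(1)] component_partner_in_req(3)[OF I c m(2) i]
    by (auto simp: bij_betw_def)
  then obtain i' where i': "Inl i' \<in> fst c" "partner m' i = partner m i'" by blast
  then have "i \<noteq> i'"
    using component_matchings_differ_everywhere[OF I c m i] by auto
  moreover have "?A \<subseteq> {1..num I}"
    using component_partner_in_req(1)[OF I c m(1)] by blast
  then have "finite ?A" by (rule finite_subset) simp
  ultimately show ?thesis
    using card_mono[of ?A "{i, i'}"] i i' by simp
qed

section \<open>The mixed integer program\<close>

lemma affine_fun_const: "affine_fun B R (\<lambda>_. k)"
  unfolding affine_fun_def by (rule exI[of _ "\<lambda>_. 0"], rule exI[of _ "\<lambda>_. 0"], rule exI[of _ k]) simp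

lemma affine_fun_bool_var:
  assumes "finite B" "i \<in> B"
  shows "affine_fun B R (\<lambda>z. real (fst z i))"
  unfolding affine_fun_def
  by (rule exI[of _ "\<lambda>j. if j = i then 1 else 0"], rule exI[of _ "\<lambda>_. 0"], rule exI[of _ 0])
     (use assms in \<open>simp add: if_distrib[of "\<lambda>x. x * _"] cong: if_cong\<close>)

lemma affine_fun_real_var:
  assumes "finite R" "i \<in> R"
  shows "affine_fun B R (\<lambda>z. snd z i)"
  unfolding affine_fun_def
  by (rule exI[of _ "\<lambda>_. 0"], rule exI[of _ "\<lambda>j. if j = i then 1 else 0"], rule exI[of _ 0])
     (use assms in \<open>simp add: if_distrib[of "\<lambda>x. x * _"] cong: if_cong\<close>)

lemma affine_fun_add:
  assumes "affine_fun B R g" "affine_fun B R h"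
  shows "affine_fun B R (\<lambda>z. g z + h z)"
proof -
  obtain a b c a' b' c' where
    "\<And>d p. g (d, p) = (\<Sum>i\<in>B. a i * real (d i)) + (\<Sum>i\<in>R. b i * p i) + c"
    "\<And>d p. h (d, p) = (\<Sum>i\<in>B. a' i * real (d i)) + (\<Sum>i\<in>R. b' i * p i) + c'"
    using assms unfolding affine_fun_def by blast
  then show ?thesis
    unfolding affine_fun_def
    by (intro exI[of _ "\<lambda>i. a i + a' i"] exI[of _ "\<lambda>i. b i + b' i"] exI[of _ "c + c'"])
       (simp add: distrib_right sum.distrib)
qed

lemma affine_fun_cmult:
  assumes "affine_fun B R g"
  shows "affine_fun B R (\<lambda>z. k * g z)"
proof -
  obtain a b c where
    "\<And>d p. g (d, p) = (\<Sum>i\<in>B. a i * real (d i)) + (\<Sum>i\<in>R. b i * p i) + c"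
    using assms unfolding affine_fun_def by blast
  then show ?thesis
    unfolding affine_fun_def
    by (intro exI[of _ "\<lambda>i. k * a i"] exI[of _ "\<lambda>i. k * b i"] exI[of _ "k * c"])
       (simp add: distrib_left sum_distrib_left mult.assoc)
qed

lemma affine_fun_diff:
  assumes "affine_fun B R g" "affine_fun B R h"
  shows "affine_fun B R (\<lambda>z. g z - h z)"
  using affine_fun_add[OF assms(1) affine_fun_cmult[OF assms(2), of "-1"]] by simp

lemma affine_fun_sum:
  assumes "\<And>x. x \<in> S \<Longrightarrow> affine_fun B R (g x)"
  shows "affine_fun B R (\<lambda>z. \<Sum>x\<in>S. g x z)"
  using assms
  by (induction S rule: infinite_finite_induct) (simp_all add: affine_fun_const affine_fun_add)

lemmas affine_fun_intros = affine_fun_const affine_fun_add affine_fun_diff affine_fun_cmult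
  affine_fun_sum affine_fun_bool_var affine_fun_real_var

text \<open>The closure rules speak of \<open>fst z\<close> and \<open>snd z\<close>;
  \<open>case_prod_unfold\<close> brings the functions on pairs in \<open>M_prog\<close> into this
  form.\<close>

lemma M_prog_linear: "mixed_integer_linear (M_prog q P PP)"
proof -
  have "affine_fun {1..q} ({0, 1} \<times> {1..q-1}) (objective (M_prog q P PP))"
    unfolding M_prog_def mip.select_convs case_prod_unfold
    by (intro affine_fun_intros) auto
  moreover have "\<forall>(l, r)\<in>set (constraints (M_prog q P PP)).
      affine_fun {1..q} ({0, 1} \<times> {1..q-1}) l \<and> affine_fun {1..q} ({0, 1} \<times> {1..q-1}) r"
    unfolding M_prog_def mip.select_convs
    by (auto simp: case_prod_unfold intro!: affine_fun_intros)
  ultimately show ?thesis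
    by (simp add: mixed_integer_linear_def M_prog_def)
qed

text \<open>The factor 4 counts two inequalities and two sign restrictions for each of the
  \<open>q - 1\<close> rows.\<close>

lemma M_prog_length_constraints: "length (constraints (M_prog q P PP)) \<le> 4 * q"
  by (simp add: M_prog_def length_concat comp_def sum_list_triv)

lemma M_prog_feasible_iff:
  "mip_feasible (M_prog q P PP) (d, p) \<longleftrightarrow>
     d \<in> bool_vectors q \<and> p \<in> extensional ({0, 1} \<times> {1..q-1}) \<and>
     (\<forall>j\<in>{1..q-1}.
        p (0, j) \<ge> (\<Sum>j'=j+1..q. PP 0 0 j j' * (1 - real (d j) - real (d j')))
                   + (\<Sum>j'=j+1..q. PP 0 1 j j' * (real (d j') - real (d j))) \<and>
        p (1, j) \<ge> (\<Sum>j'=j+1..q. PP 1 0 j j' * (real (d j) - real (d j')))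
                   + (\<Sum>j'=j+1..q. PP 1 1 j j' * (real (d j) + real (d j') - 1)) \<and>
        p (0, j) \<ge> 0 \<and> p (1, j) \<ge> 0)"
proof -
  \<comment> \<open>This includes \<open>q = 0\<close>, where truncated subtraction makes both sides
    empty.\<close>
  have "set [1..<q] = {1..q-1}" by auto
  then show ?thesis
    by (auto simp: mip_feasible_def M_prog_def bool_vectors_def PiE_def)
qed

lemma bool_vectors_cases:
  assumes "d \<in> bool_vectors q" "j \<in> {1..q}"
  shows "d j = 0 \<or> d j = 1"
  using assms by (auto simp: bool_vectors_def)

text \<open>For Boolean values exactly one of the four products of each pair equals 1, namely the
  one that selects the coefficient with upper index \<open>(d j, d j')\<close>.\<close>

lemma Q_obj_bool:
  assumes d: "d \<in> bool_vectors q"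
  shows "Q_obj q P PP d = (\<Sum>j=1..q-1. \<Sum>j'=j+1..q. PP (d j) (d j') j j') + (\<Sum>j=1..q. P (d j) j)"
proof -
  have "PP 0 0 j j' * (1 - real (d j)) * (1 - real (d j'))
      + PP 0 1 j j' * (1 - real (d j)) * real (d j')
      + PP 1 0 j j' * real (d j) * (1 - real (d j'))
      + PP 1 1 j j' * real (d j) * real (d j') = PP (d j) (d j') j j'"
    if "j \<in> {1..q-1}" "j' \<in> {j+1..q}" for j j'
    using bool_vectors_cases[OF d, of j] bool_vectors_cases[OF d, of j'] that by auto
  moreover have "P 0 j * (1 - real (d j)) + P 1 j * real (d j) = P (d j) j" if "j \<in> {1..q}" for j
    using bool_vectors_cases[OF d that] by auto
  ultimately show ?thesis
    unfolding Q_obj_def by simp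
qed

lemma M_prog_objective_bool:
  assumes d: "d \<in> bool_vectors q"
  shows "objective (M_prog q P PP) (d, p) = (\<Sum>j=1..q-1. p (0, j) + p (1, j)) + (\<Sum>j=1..q. P (d j) j)"
proof -
  have "P 0 j * (1 - real (d j)) + P 1 j * real (d j) = P (d j) j" if "j \<in> {1..q}" for j
    using bool_vectors_cases[OF d that] by auto
  then show ?thesis
    by (simp add: M_prog_def)
qed

text \<open>The right-hand side of the constraint with upper index \<open>d j\<close> is the quadratic cost of row
  \<open>j\<close>, and that of the other constraint is nonpositive because the coefficients are nonnegative.\<close>

lemma M_prog_rows:
  assumes d: "d \<in> bool_vectors q" and j: "j \<in> {1..q-1}"
    and nonneg: "\<And>k l j'. k \<in> {0, 1} \<Longrightarrow> l \<in> {0, 1} \<Longrightarrow> j' \<in> {j+1..q} \<Longrightarrow> PP k l j j' \<ge> (0::real)"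
  shows "d j = 0 \<Longrightarrow>
      (\<Sum>j'=j+1..q. PP 0 0 j j' * (1 - real (d j) - real (d j')))
      + (\<Sum>j'=j+1..q. PP 0 1 j j' * (real (d j') - real (d j))) = (\<Sum>j'=j+1..q. PP (d j) (d j') j j')"
    and "d j = 1 \<Longrightarrow>
      (\<Sum>j'=j+1..q. PP 0 0 j j' * (1 - real (d j) - real (d j')))
      + (\<Sum>j'=j+1..q. PP 0 1 j j' * (real (d j') - real (d j))) \<le> 0"
    and "d j = 1 \<Longrightarrow>
      (\<Sum>j'=j+1..q. PP 1 0 j j' * (real (d j) - real (d j')))
      + (\<Sum>j'=j+1..q. PP 1 1 j j' * (real (d j) + real (d j') - 1)) = (\<Sum>j'=j+1..q. PP (d j) (d j') j j')"
    and "d j = 0 \<Longrightarrow>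
      (\<Sum>j'=j+1..q. PP 1 0 j j' * (real (d j) - real (d j')))
      + (\<Sum>j'=j+1..q. PP 1 1 j j' * (real (d j) + real (d j') - 1)) \<le> 0"
proof -
  have b: "d j' = 0 \<or> d j' = 1" if "j' \<in> {j+1..q}" for j'
    using bool_vectors_cases[OF d, of j'] that by auto
  note simps = sum.distrib[symmetric]
  show "(\<Sum>j'=j+1..q. PP 0 0 j j' * (1 - real (d j) - real (d j')))
      + (\<Sum>j'=j+1..q. PP 0 1 j j' * (real (d j') - real (d j))) = (\<Sum>j'=j+1..q. PP (d j) (d j') j j')"
    if "d j = 0"
    unfolding simps by (rule sum.cong) (use b that in force)+
  show "(\<Sum>j'=j+1..q. PP 1 0 j j' * (real (d j) - real (d j')))
      + (\<Sum>j'=j+1..q. PP 1 1 j j' * (real (d j) + real (d j') - 1)) = (\<Sum>j'=j+1..q. PP (d j) (d j') j j')"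
    if "d j = 1"
    unfolding simps by (rule sum.cong) (use b that in force)+
  show "(\<Sum>j'=j+1..q. PP 0 0 j j' * (1 - real (d j) - real (d j')))
      + (\<Sum>j'=j+1..q. PP 0 1 j j' * (real (d j') - real (d j))) \<le> 0" if "d j = 1"
    unfolding simps
  proof (rule sum_nonpos)
    fix j' assume j': "j' \<in> {j+1..q}"
    \<comment> \<open>For \<open>d j = 1\<close> the two factors are \<open>- d j'\<close> and
      \<open>d j' - 1\<close>, neither of them positive. The same factors arise below for
      \<open>d j = 0\<close>.\<close>
    show "PP 0 0 j j' * (1 - real (d j) - real (d j')) + PP 0 1 j j' * (real (d j') - real (d j)) \<le> 0"
      using b[OF j'] nonneg[OF _ _ j', of 0 0] nonneg[OF _ _ j', of 0 1] that by auto
  qed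
  show "(\<Sum>j'=j+1..q. PP 1 0 j j' * (real (d j) - real (d j')))
      + (\<Sum>j'=j+1..q. PP 1 1 j j' * (real (d j) + real (d j') - 1)) \<le> 0" if "d j = 0"
    unfolding simps
  proof (rule sum_nonpos)
    fix j' assume j': "j' \<in> {j+1..q}"
    show "PP 1 0 j j' * (real (d j) - real (d j')) + PP 1 1 j j' * (real (d j) + real (d j') - 1) \<le> 0"
      using b[OF j'] nonneg[OF _ _ j', of 1 0] nonneg[OF _ _ j', of 1 1] that by auto
  qed
qed

text \<open>Row by row: the variable with upper index \<open>d j\<close> is bounded below by the row
  cost through its constraint, and the other one by 0.\<close>

lemma Q_obj_le_M_objective:
  assumes nonneg: "\<And>k l j j'. k \<in> {0, 1} \<Longrightarrow> l \<in> {0, 1} \<Longrightarrow> j \<in> {1..q} \<Longrightarrow> j' \<in> {j+1..q} \<Longrightarrow>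
      PP k l j j' \<ge> 0"
    and feas: "mip_feasible (M_prog q P PP) (d, p)"
  shows "Q_obj q P PP d \<le> objective (M_prog q P PP) (d, p)"
proof -
  have d: "d \<in> bool_vectors q"
    using feas by (simp add: M_prog_feasible_iff)
  have "(\<Sum>j'=j+1..q. PP (d j) (d j') j j') \<le> p (0, j) + p (1, j)" if j: "j \<in> {1..q-1}" for j
  proof -
    have nn: "PP k l j j' \<ge> 0" if "k \<in> {0, 1}" "l \<in> {0, 1}" "j' \<in> {j+1..q}" for k l j'
      using nonneg[of k l j j'] that j by auto
    note rows = M_prog_rows(1,3)[where PP = PP, OF d j nn]
    have "d j = 0 \<or> d j = 1"
      using bool_vectors_cases[OF d, of j] j by auto
    then show ?thesis
    proof
      assume "d j = 0"
      with rows(1) feas j show ?thesis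
        unfolding M_prog_feasible_iff by fastforce
    next
      assume "d j = 1"
      with rows(2) feas j show ?thesis
        unfolding M_prog_feasible_iff by fastforce
    qed
  qed
  then show ?thesis
    unfolding Q_obj_bool[OF d] M_prog_objective_bool[OF d] by (intro add_right_mono sum_mono)
qed

lemma M_objective_attains_Q_obj:
  assumes nonneg: "\<And>k l j j'. k \<in> {0, 1} \<Longrightarrow> l \<in> {0, 1} \<Longrightarrow> j \<in> {1..q} \<Longrightarrow> j' \<in> {j+1..q} \<Longrightarrow>
      PP k l j j' \<ge> 0"
    and d: "d \<in> bool_vectors q"
  shows "\<exists>p. mip_feasible (M_prog q P PP) (d, p) \<and> objective (M_prog q P PP) (d, p) = Q_obj q P PP d"
proof -
  define p where "p = restrict (\<lambda>(k, j). if d j = k then \<Sum>j'=j+1..q. PP (d j) (d j') j j' else 0)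
    ({0::nat, 1} \<times> {1..q-1})"
  have p: "p (k, j) = (if d j = k then \<Sum>j'=j+1..q. PP (d j) (d j') j j' else 0)"
    if "j \<in> {1..q-1}" "k \<in> {0, 1}" for j k
    using that by (simp add: p_def)
  have b: "d j = 0 \<or> d j = 1" if "j \<in> {1..q-1}" for j
    using bool_vectors_cases[OF d, of j] that by auto
  have "mip_feasible (M_prog q P PP) (d, p)"
    unfolding M_prog_feasible_iff
  proof (intro conjI ballI d)
    show "p \<in> extensional ({0, 1} \<times> {1..q-1})"
      by (simp add: p_def)
    fix j assume j: "j \<in> {1..q-1}"
    have nn: "PP k l j j' \<ge> 0" if "k \<in> {0, 1}" "l \<in> {0, 1}" "j' \<in> {j+1..q}" for k l j'
      using nonneg[of k l j j'] that j by auto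
    note rows = M_prog_rows[where PP = PP, OF d j nn]
    \<comment> \<open>The row cost becomes the value of a variable of \<open>p\<close>, which must
      satisfy its sign restriction.\<close>
    have r: "(\<Sum>j'=j+1..q. PP (d j) (d j') j j') \<ge> 0"
    proof (rule sum_nonneg)
      fix j' assume j': "j' \<in> {j+1..q}"
      show "PP (d j) (d j') j j' \<ge> 0"
        using nn[of "d j" "d j'" j'] b[OF j] bool_vectors_cases[OF d, of j'] j' by auto
    qed
    show "p (0, j) \<ge> (\<Sum>j'=j+1..q. PP 0 0 j j' * (1 - real (d j) - real (d j')))
                   + (\<Sum>j'=j+1..q. PP 0 1 j j' * (real (d j') - real (d j)))"
      using b[OF j] rows(1,2) p[OF j, of 0] by (cases "d j = 0") simp_all
    show "p (1, j) \<ge> (\<Sum>j'=j+1..q. PP 1 0 j j' * (real (d j) - real (d j')))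
                   + (\<Sum>j'=j+1..q. PP 1 1 j j' * (real (d j) + real (d j') - 1))"
      using b[OF j] rows(3,4) p[OF j, of 1] by (cases "d j = 0") simp_all
    show "p (0, j) \<ge> 0" "p (1, j) \<ge> 0"
      using p[OF j, of 0] p[OF j, of 1] r by (cases "d j = 0"; cases "d j = 1"; simp)+
  qed
  moreover have "p (0, j) + p (1, j) = (\<Sum>j'=j+1..q. PP (d j) (d j') j j')" if "j \<in> {1..q-1}" for j
    using b[OF that] p[OF that, of 0] p[OF that, of 1] by (cases "d j = 0"; simp)
  then have "objective (M_prog q P PP) (d, p) = Q_obj q P PP d"
    unfolding Q_obj_bool[OF d] M_prog_objective_bool[OF d] by simp
  ultimately show ?thesis by blast
qed

lemma ex_Q_optimal: "\<exists>d. is_arg_min (Q_obj q P PP) (\<lambda>d. d \<in> bool_vectors q) d"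
proof (rule ex_is_arg_min_if_finite)
  show "finite (bool_vectors q)"
    by (auto simp: bool_vectors_def intro: finite_PiE)
  show "bool_vectors q \<noteq> {}"
    by (auto simp: bool_vectors_def PiE_eq_empty_iff)
qed

text \<open>By the two preceding lemmas \<open>Q d\<close> is the minimum of the objective of
  \<open>M\<close> over all \<open>p\<close> feasible together with \<open>d\<close>. Projecting
  \<open>p\<close> out therefore transfers minimizers in both directions.\<close>

lemma Q_M_equivalent:
  fixes P :: "nat \<Rightarrow> nat \<Rightarrow> real" and PP :: "nat \<Rightarrow> nat \<Rightarrow> nat \<Rightarrow> nat \<Rightarrow> real"
  assumes nonneg: "\<And>k l j j'. k \<in> {0, 1} \<Longrightarrow> l \<in> {0, 1} \<Longrightarrow> j \<in> {1..q} \<Longrightarrow> j' \<in> {j+1..q} \<Longrightarrow>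
      PP k l j j' \<ge> 0"
  defines "Q \<equiv> Q_obj q P PP" and "M \<equiv> M_prog q P PP"
  shows "\<exists>v. optimal_value Q (\<lambda>d. d \<in> bool_vectors q) v \<and> optimal_value (objective M) (mip_feasible M) v"
    and "is_arg_min (objective M) (mip_feasible M) (d, p) \<Longrightarrow>
      is_arg_min Q (\<lambda>d. d \<in> bool_vectors q) d"
    and "is_arg_min Q (\<lambda>d. d \<in> bool_vectors q) d \<Longrightarrow>
      \<exists>p. is_arg_min (objective M) (mip_feasible M) (d, p)"
proof -
  have le: "Q d \<le> objective M (d, p)" if "mip_feasible M (d, p)" for d p
    unfolding Q_def M_def by (rule Q_obj_le_M_objective[OF _ that[unfolded M_def]]) (rule nonneg)
  have att: "\<exists>p. mip_feasible M (d, p) \<and> objective M (d, p) = Q d" if "d \<in> bool_vectors q" for d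
    unfolding Q_def M_def by (rule M_objective_attains_Q_obj[OF _ that]) (rule nonneg)
  have bv: "d \<in> bool_vectors q" if "mip_feasible M (d, p)" for d p
    using that by (simp add: M_def M_prog_feasible_iff)
  have lift: "\<exists>p. is_arg_min (objective M) (mip_feasible M) (d, p) \<and> objective M (d, p) = Q d"
    if d: "is_arg_min Q (\<lambda>d. d \<in> bool_vectors q) d" for d
  proof -
    obtain p where p: "mip_feasible M (d, p)" "objective M (d, p) = Q d"
      using att d by (auto simp: is_arg_min_def)
    have "Q d \<le> objective M (d', p')" if "mip_feasible M (d', p')" for d' p'
      using d bv[OF that] le[OF that] by (force simp: is_arg_min_def)
    then show ?thesis
      using p by (force simp: is_arg_min_def)
  qed
  then show "is_arg_min Q (\<lambda>d. d \<in> bool_vectors q) d \<Longrightarrow>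
      \<exists>p. is_arg_min (objective M) (mip_feasible M) (d, p)"
    by blast
  show "is_arg_min Q (\<lambda>d. d \<in> bool_vectors q) d"
    if "is_arg_min (objective M) (mip_feasible M) (d, p)"
  proof -
    have "\<not> Q d' < Q d" if "d' \<in> bool_vectors q" for d'
      using att[OF that] le[of d p] \<open>is_arg_min (objective M) _ _\<close> by (force simp: is_arg_min_def)
    then show ?thesis
      using that bv by (auto simp: is_arg_min_def)
  qed
  show "\<exists>v. optimal_value Q (\<lambda>d. d \<in> bool_vectors q) v \<and> optimal_value (objective M) (mip_feasible M) v"
    \<comment> \<open>The feasible set of (M) may be infinite, so its minimum is obtained by lifting
      one of (Q), which ranges over finitely many vectors.\<close>
    using ex_Q_optimal[of q P PP] lift unfolding optimal_value_def Q_def by blast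
qed

section \<open>Feasible solutions as choices of matchings\<close>

locale labelled_tspvr =
  fixes I :: "'a tspvr"
    and cyc :: "nat \<Rightarrow> (nat + 'a) graph"
    and w :: "nat \<Rightarrow> nat \<Rightarrow> (nat + 'a) set set"
  assumes inst: "two_tspvr I" and feas: "feasible I" and lab: "cycle_labelling I cyc w"
begin

abbreviation "specials \<equiv> special_vertices (bip_graph I)"

abbreviation "cycles \<equiv> {1..num_cycles I}"

abbreviation "positions \<equiv> {1..num I}"

lemma cyc_component: "j \<in> cycles \<Longrightarrow> cyc j \<in> graph_components (reduced_graph I)"
  using lab bij_betwE unfolding cycle_labelling_def by blast

lemma w_perfect: "j \<in> cycles \<Longrightarrow> k \<in> {0, 1} \<Longrightarrow> perfect_matching (cyc j) (w k j)"
  using lab by (auto simp: cycle_labelling_def)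

lemma w_distinct: "j \<in> cycles \<Longrightarrow> w 0 j \<noteq> w 1 j"
  using lab by (auto simp: cycle_labelling_def)

lemma cyc_vertices:
  assumes "j \<in> cycles" "v \<in> fst (cyc j)"
  shows "v \<in> fst (bip_graph I)" "v \<notin> specials"
  using component_vertices_subset[OF cyc_component[OF assms(1)]] assms(2)
  by (auto simp: reduced_graph_simps)

lemma cyc_unique:
  assumes "j \<in> cycles" "j' \<in> cycles" "v \<in> fst (cyc j)" "v \<in> fst (cyc j')"
  shows "j = j'"
proof -
  have "cyc j = cyc j'"
    by (rule component_disjoint[OF cyc_component cyc_component]) fact+
  moreover have "inj_on cyc cycles"
    using lab by (auto simp: cycle_labelling_def bij_betw_def)
  ultimately show ?thesis
    using assms(1,2) by (auto dest: inj_onD)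
qed

lemma vertex_cases:
  assumes "v \<in> fst (bip_graph I)"
  obtains "v \<in> specials" | j where "j \<in> cycles" "v \<in> fst (cyc j)"
proof (cases "v \<in> specials")
  case False
  then obtain c where c: "c \<in> graph_components (reduced_graph I)" "v \<in> fst c"
    using assms component_cover[of v "reduced_graph I"] by (auto simp: reduced_graph_simps)
  then have "c \<in> cyc ` cycles"
    using lab by (simp add: cycle_labelling_def bij_betw_def)
  then show ?thesis using that(2) c by blast
qed (use that in blast)

lemma position_vertex: "Inl i \<in> fst (bip_graph I) \<longleftrightarrow> i \<in> positions"
  by (auto simp: bip_graph_def)

text \<open>With all cycles this is the matching of \<open>sol_of I w d\<close>; with one or two
  cycles it is the edge set in \<open>P_single\<close> or \<open>P_pair\<close>. The common form
  makes their arcs comparable.\<close>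

definition choice :: "nat set \<Rightarrow> (nat \<Rightarrow> nat) \<Rightarrow> (nat + 'a) set set" where
  "choice J k = special_edges (bip_graph I) \<union> (\<Union>j\<in>J. w (k j) j)"

lemma w_edge_subset:
  assumes "j \<in> cycles" "k \<in> {0, 1}" "e \<in> w k j"
  shows "e \<subseteq> fst (cyc j)" "e \<in> snd (bip_graph I)"
proof -
  have "e \<in> snd (cyc j)"
    using w_perfect[OF assms(1,2)] assms(3) by (auto simp: perfect_matching_def)
  then show "e \<subseteq> fst (cyc j)" "e \<in> snd (bip_graph I)"
    by (simp_all add: component_quotient(2)[OF cyc_component[OF assms(1)]] reduced_graph_simps)
qed

lemma special_edge_vertex:
  assumes "e \<in> special_edges (bip_graph I)" "v \<in> e"
  shows "v \<in> specials"
proof -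
  have "e \<in> snd (bip_graph I)"
    using assms(1) by (simp add: special_edges_def)
  then have "v \<in> fst (bip_graph I)"
    using bip_graph_bipartite[OF inst] assms(2) unfolding bipartite_def by fastforce
  then show ?thesis
    using assms by (auto simp: special_vertices_def)
qed

text \<open>Locality: special edges have only special ends, and other cycles are disjoint from cycle
  \<open>j\<close>, so at a vertex of cycle \<open>j\<close> only the matching chosen there is
  visible.\<close>

lemma choice_edge_cycle:
  assumes J: "J \<subseteq> cycles" "j \<in> J" and k: "k \<in> J \<rightarrow> {0, 1}" and v: "v \<in> fst (cyc j)" "v \<in> e"
  shows "e \<in> choice J k \<longleftrightarrow> e \<in> w (k j) j"
proof
  assume "e \<in> choice J k"
  then consider "e \<in> special_edges (bip_graph I)" | j' where "j' \<in> J" "e \<in> w (k j') j'"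
    by (auto simp: choice_def)
  then show "e \<in> w (k j) j"
  proof cases
    case 1
    have "j \<in> cycles" using J by blast
    then show ?thesis
      using special_edge_vertex[OF 1 v(2)] cyc_vertices(2)[of j v] v(1) by blast
  next
    case 2
    have "j \<in> cycles" "j' \<in> cycles" "k j' \<in> {0, 1}"
      using J k 2 by blast+
    then have "v \<in> fst (cyc j')"
      using w_edge_subset(1)[of j' "k j'" e] 2 v by blast
    then have "j' = j"
      using cyc_unique[of j' j v] v \<open>j \<in> cycles\<close> \<open>j' \<in> cycles\<close> by blast
    then show ?thesis using 2 by simp
  qed
qed (use J in \<open>auto simp: choice_def\<close>)

lemma choice_edge_special:
  assumes J: "J \<subseteq> cycles" and k: "k \<in> J \<rightarrow> {0, 1}" and v: "v \<in> specials" "v \<in> e"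
  shows "e \<in> choice J k \<longleftrightarrow> e \<in> special_edges (bip_graph I)"
proof
  assume "e \<in> choice J k"
  then consider "e \<in> special_edges (bip_graph I)" | j where "j \<in> J" "e \<in> w (k j) j"
    by (auto simp: choice_def)
  then show "e \<in> special_edges (bip_graph I)"
  proof cases
    case 2
    have "j \<in> cycles" "k j \<in> {0, 1}"
      using J k 2 by blast+
    then show ?thesis
      using w_edge_subset(1)[of j "k j" e] cyc_vertices(2)[of j v] 2 v by blast
  qed
qed (simp add: choice_def)

lemma partner_choice_cycle:
  assumes "J \<subseteq> cycles" "j \<in> J" "k \<in> J \<rightarrow> {0, 1}" "Inl i \<in> fst (cyc j)"
  shows "partner (choice J k) i = partner (w (k j) j) i"
  by (rule partner_cong, rule choice_edge_cycle[OF assms]) simp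

lemma partner_choice_special:
  assumes "J \<subseteq> cycles" "k \<in> J \<rightarrow> {0, 1}" "Inl i \<in> specials"
  shows "partner (choice J k) i = partner (special_edges (bip_graph I)) i"
  by (rule partner_cong, rule choice_edge_special[OF assms]) simp

lemma ex_perfect_matching: "\<exists>M. perfect_matching (bip_graph I) M"
  using feas perfect_matching_of_solution[of _ I] unfolding feasible_def by blast

lemma bool_vectors_funcset: "d \<in> bool_vectors (num_cycles I) \<Longrightarrow> d \<in> cycles \<rightarrow> {0, 1}"
  by (simp add: bool_vectors_def PiE_def)

lemma choice_perfect:
  assumes d: "d \<in> bool_vectors (num_cycles I)"
  shows "perfect_matching (bip_graph I) (choice cycles d)"
  unfolding perfect_matching_def
proof (intro conjI ballI)
  note d' = bool_vectors_funcset[OF d]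
  show "choice cycles d \<subseteq> snd (bip_graph I)"
  proof
    fix e assume "e \<in> choice cycles d"
    then consider "e \<in> special_edges (bip_graph I)" | j where "j \<in> cycles" "e \<in> w (d j) j"
      by (auto simp: choice_def)
    then show "e \<in> snd (bip_graph I)"
    proof cases
      case 1 then show ?thesis by (simp add: special_edges_def)
    next
      case 2 then show ?thesis using w_edge_subset(2)[of j "d j" e] d' by blast
    qed
  qed
  fix v assume v: "v \<in> fst (bip_graph I)"
  then show "\<exists>!e. e \<in> choice cycles d \<and> v \<in> e"
  proof (cases rule: vertex_cases)
    case 1
    obtain e where e: "e \<in> special_edges (bip_graph I)" "v \<in> e"
      using 1 by (auto simp: special_vertices_def)
    \<comment> \<open>Feasibility is essential: all special edges lie in \<open>M\<close>, which has
      only one edge at \<open>v\<close>. Without any perfect matching every edge would be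
      special.\<close>
    obtain M where M: "perfect_matching (bip_graph I) M"
      using ex_perfect_matching by blast
    have "e' = e" if "e' \<in> special_edges (bip_graph I)" "v \<in> e'" for e'
    proof -
      have "e \<in> M" "e' \<in> M"
        using M e that by (auto simp: special_edges_def)
      then show ?thesis
        using perfect_matching_ex1[OF M v] e that by blast
    qed
    then have "\<exists>!e. e \<in> special_edges (bip_graph I) \<and> v \<in> e"
      using e by blast
    moreover have "e \<in> choice cycles d \<and> v \<in> e \<longleftrightarrow> e \<in> special_edges (bip_graph I) \<and> v \<in> e" for e
      using choice_edge_special[OF order_refl d' 1] by blast
    ultimately show ?thesis by simp
  next
    case (2 j)
    have "\<exists>!e. e \<in> w (d j) j \<and> v \<in> e"
      by (rule perfect_matching_ex1[OF w_perfect[OF 2(1)] 2(2)]) (use d' 2(1) in blast)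
    moreover have "e \<in> choice cycles d \<and> v \<in> e \<longleftrightarrow> e \<in> w (d j) j \<and> v \<in> e" for e
      using choice_edge_cycle[OF order_refl 2(1) d' 2(2)] by blast
    ultimately show ?thesis by simp
  qed
qed

lemma sol_of_choice: "sol_of I w d = restrict (partner (choice cycles d)) positions"
  by (simp add: sol_of_def choice_def)

lemma sol_of_solution:
  assumes d: "d \<in> bool_vectors (num_cycles I)"
  shows "sol_of I w d \<in> solutions I"
proof -
  note bip = bip_graph_bipartite[OF inst]
  note pm = choice_perfect[OF d]
  have "{i. (Inl i :: nat + 'a) \<in> fst (bip_graph I)} = positions" "{x. Inr x \<in> fst (bip_graph I)} = verts I"
    by (auto simp: bip_graph_def)
  then have "bij_betw (partner (choice cycles d)) positions (verts I)"
    using perfect_matching_bij_betw[OF bip pm] by simp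
  moreover have "partner (choice cycles d) i \<in> req I i" if "i \<in> positions" for i
  proof -
    have "{Inl i, Inr (partner (choice cycles d) i)} \<in> choice cycles d"
      using partner_eq_iff[OF bip pm] that position_vertex by blast
    then have "{Inl i, Inr (partner (choice cycles d) i)} \<in> snd (bip_graph I)"
      using pm by (auto simp: perfect_matching_def)
    then show ?thesis by (simp add: bip_graph_edge_iff)
  qed
  moreover have "bij_betw (restrict g positions) positions (verts I) \<longleftrightarrow> bij_betw g positions (verts I)"
    for g :: "nat \<Rightarrow> 'a"
    by (rule bij_betw_cong) simp
  ultimately show ?thesis
    unfolding solutions_def sol_of_choice by (simp add: restrict_PiE_iff)
qed

text \<open>Every perfect matching contains all special edges and restricts on each cycle to one of
  its two matchings, which yields the vector \<open>d\<close>.\<close>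

lemma solution_is_sol_of:
  assumes f: "f \<in> solutions I"
  shows "\<exists>d\<in>bool_vectors (num_cycles I). f = sol_of I w d"
proof -
  define M where "M = (\<lambda>i. {Inl i, Inr (f i)}) ` positions"
  have M: "perfect_matching (bip_graph I) M"
    unfolding M_def by (rule perfect_matching_of_solution[OF f])
  have "\<exists>k\<in>{0, 1}. {e \<in> M. e \<subseteq> fst (cyc j)} = w k j" if j: "j \<in> cycles" for j
  proof -
    have "{e \<in> M. e \<subseteq> fst (cyc j)} = w 0 j \<or> {e \<in> M. e \<subseteq> fst (cyc j)} = w 1 j"
      using component_two_matchings[OF inst cyc_component[OF j] w_perfect[OF j] w_perfect[OF j] w_distinct[OF j]
          perfect_matching_restrict(1)[OF inst M cyc_component[OF j]]]
      by simp
    then show ?thesis by blast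
  qed
  then obtain k where k: "\<And>j. j \<in> cycles \<Longrightarrow> k j \<in> {0, 1} \<and> {e \<in> M. e \<subseteq> fst (cyc j)} = w (k j) j"
    by metis
  define d where "d = restrict k cycles"
  have d: "d \<in> bool_vectors (num_cycles I)"
    unfolding bool_vectors_def d_def using k by (intro restrict_PiE_iff[THEN iffD2]) blast
  have "f i = partner (choice cycles d) i" if i: "i \<in> positions" for i
  proof -
    let ?e = "{Inl i, Inr (f i)}"
    have e: "?e \<in> M"
      using i by (simp add: M_def)
    have iV: "Inl i \<in> fst (bip_graph I)"
      using i position_vertex by blast
    then have "?e \<in> choice cycles d"
    proof (cases rule: vertex_cases)
      case 1
      then obtain e' where e': "e' \<in> special_edges (bip_graph I)" "Inl i \<in> e'"
        by (auto simp: special_vertices_def)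
      have "e' \<in> M"
        using e' M by (simp add: special_edges_def)
      then have "e' = ?e"
        using perfect_matching_ex1[OF M iV] e e' by blast
      then show ?thesis
        using e' by (simp add: choice_def)
    next
      case (2 j)
      have "?e \<subseteq> fst (cyc j)"
        by (rule perfect_matching_restrict(2)[OF inst M cyc_component[OF 2(1)] 2(2) e]) simp
      then have "?e \<in> w (d j) j"
        using k[OF 2(1)] 2(1) e by (auto simp: d_def)
      then show ?thesis
        using 2(1) by (auto simp: choice_def)
    qed
    then show ?thesis
      using partner_eq_iff[OF bip_graph_bipartite[OF inst] choice_perfect[OF d] iV] by simp
  qed
  moreover have "f \<in> extensional positions"
    using f by (simp add: solutions_def PiE_def)
  ultimately have "f = sol_of I w d"
    unfolding sol_of_choice by (intro extensionalityI[where A = positions]) auto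
  then show ?thesis using d by blast
qed

section \<open>Cost of a tour as a sum over contacts\<close>

text \<open>Cycles are numbered from 1, so 0 is free to mark special positions. The kind of a
  contact can then be read off the labels of its two ends.\<close>

definition cycle_index :: "nat \<Rightarrow> nat" where
  "cycle_index i = (if Inl i \<in> specials then 0 else THE j. j \<in> cycles \<and> Inl i \<in> fst (cyc j))"

lemma cycle_index_iff:
  assumes i: "i \<in> positions"
  shows "cycle_index i = 0 \<longleftrightarrow> Inl i \<in> specials"
    and "j \<in> cycles \<Longrightarrow> cycle_index i = j \<longleftrightarrow> Inl i \<in> fst (cyc j)"
    and "cycle_index i \<le> num_cycles I"
proof -
  have iV: "Inl i \<in> fst (bip_graph I)"
    using i position_vertex by blast
  have the: "cycle_index i = j" if "j \<in> cycles" "Inl i \<in> fst (cyc j)" for j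
  proof -
    have "(THE j. j \<in> cycles \<and> Inl i \<in> fst (cyc j)) = j"
      by (rule the_equality) (use that cyc_unique in blast)+
    then show ?thesis
      using cyc_vertices(2)[OF that] by (simp add: cycle_index_def)
  qed
  from iV have "(cycle_index i = 0 \<longleftrightarrow> Inl i \<in> specials) \<and>
    (\<forall>j\<in>cycles. cycle_index i = j \<longleftrightarrow> Inl i \<in> fst (cyc j)) \<and> cycle_index i \<le> num_cycles I"
  proof (cases rule: vertex_cases)
    case 1
    then show ?thesis
      using cyc_vertices(2) by (auto simp: cycle_index_def)
  next
    case (2 j)
    have "j = j' \<longleftrightarrow> Inl i \<in> fst (cyc j')" if "j' \<in> cycles" for j'
      using cyc_unique[OF 2(1) that 2(2)] 2(2) by blast
    then show ?thesis
      using cyc_vertices(2)[OF 2] 2(1) by (simp add: the[OF 2])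
  qed
  then show "cycle_index i = 0 \<longleftrightarrow> Inl i \<in> specials"
    "j \<in> cycles \<Longrightarrow> cycle_index i = j \<longleftrightarrow> Inl i \<in> fst (cyc j)"
    "cycle_index i \<le> num_cycles I"
    by blast+
qed

lemma cyc_suc_position: "i \<in> positions \<Longrightarrow> cyc_suc (num I) i \<in> positions"
  by (auto simp: cyc_suc_def)

lemma single_contacts_eq:
  assumes "j \<in> cycles"
  shows "inside_contacts I cyc j \<union> special_contacts I cyc j =
    (let a = cycle_index; b = \<lambda>i. cycle_index (cyc_suc (num I) i) in
      {i \<in> positions. a i = j \<and> b i = j \<or> a i = j \<and> b i = 0 \<or> a i = 0 \<and> b i = j})"
proof (rule set_eqI)
  fix i
  note iff = cycle_index_iff(1) cycle_index_iff(2)[OF _ assms]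
  show "i \<in> inside_contacts I cyc j \<union> special_contacts I cyc j \<longleftrightarrow> i \<in> (let a = cycle_index; b = \<lambda>i. cycle_index (cyc_suc (num I) i) in
      {i \<in> positions. a i = j \<and> b i = j \<or> a i = j \<and> b i = 0 \<or> a i = 0 \<and> b i = j})"
  proof (cases "i \<in> positions")
    case True
    show ?thesis
      unfolding inside_contacts_def special_contacts_def Let_def
      using True iff[OF True] iff[OF cyc_suc_position[OF True]] by blast
  qed (simp add: inside_contacts_def special_contacts_def Let_def del: atLeastAtMost_iff)
qed

lemma between_contacts_eq:
  assumes "j \<in> cycles" "j' \<in> cycles"
  shows "between_contacts I cyc j j' =
    (let a = cycle_index; b = \<lambda>i. cycle_index (cyc_suc (num I) i) in
      {i \<in> positions. a i = j \<and> b i = j' \<or> a i = j' \<and> b i = j})"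
proof (rule set_eqI)
  fix i
  note iff = cycle_index_iff(2)[OF _ assms(1)] cycle_index_iff(2)[OF _ assms(2)]
  show "i \<in> between_contacts I cyc j j' \<longleftrightarrow> i \<in> (let a = cycle_index; b = \<lambda>i. cycle_index (cyc_suc (num I) i) in
      {i \<in> positions. a i = j \<and> b i = j' \<or> a i = j' \<and> b i = j})"
  proof (cases "i \<in> positions")
    case True
    show ?thesis
      unfolding between_contacts_def Let_def
      using True iff[OF True] iff[OF cyc_suc_position[OF True]] by blast
  qed (simp add: between_contacts_def Let_def del: atLeastAtMost_iff)
qed

lemma partner_choice_cong:
  assumes J: "J \<subseteq> cycles" "J' \<subseteq> cycles" and k: "k \<in> J \<rightarrow> {0, 1}" "k' \<in> J' \<rightarrow> {0, 1}"
    and i: "Inl i \<in> specials \<or> (\<exists>j\<in>J \<inter> J'. k j = k' j \<and> Inl i \<in> fst (cyc j))"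
  shows "partner (choice J k) i = partner (choice J' k') i"
  using i
proof
  assume "Inl i \<in> specials"
  then show ?thesis
    using partner_choice_special J k by metis
next
  assume "\<exists>j\<in>J \<inter> J'. k j = k' j \<and> Inl i \<in> fst (cyc j)"
  then obtain j where "j \<in> J" "j \<in> J'" "k j = k' j" "Inl i \<in> fst (cyc j)" by blast
  then show ?thesis
    using partner_choice_cycle[OF J(1) _ k(1)] partner_choice_cycle[OF J(2) _ k(2)] by metis
qed

text \<open>An arc depends only on the matching edges at its two ends, which here are special or on
  cycle \<open>j\<close>. Adding the matchings of all other cycles leaves it unchanged.\<close>

lemma P_single_eq:
  assumes d: "d \<in> bool_vectors (num_cycles I)" and j: "j \<in> cycles"
  shows "P_single I cyc w (d j) j =
    (\<Sum>i\<in>inside_contacts I cyc j \<union> special_contacts I cyc j. arc_weight I (choice cycles d) i)"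
  unfolding P_single_def
proof (rule sum.cong[OF refl])
  fix i assume i: "i \<in> inside_contacts I cyc j \<union> special_contacts I cyc j"
  note d' = bool_vectors_funcset[OF d]
  have eq: "special_edges (bip_graph I) \<union> w (d j) j = choice {j} d"
    by (simp add: choice_def)
  have "partner (choice {j} d) p = partner (choice cycles d) p"
    if "Inl p \<in> specials \<or> Inl p \<in> fst (cyc j)" for p
    by (rule partner_choice_cong) (use that j d' in auto)
  moreover have "\<forall>p\<in>{i, cyc_suc (num I) i}. Inl p \<in> specials \<or> Inl p \<in> fst (cyc j)"
    using i by (auto simp: inside_contacts_def special_contacts_def Let_def)
  ultimately show "arc_weight I (special_edges (bip_graph I) \<union> w (d j) j) i =
      arc_weight I (choice cycles d) i"
    unfolding eq arc_weight_def by simp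
qed

lemma P_pair_eq:
  assumes d: "d \<in> bool_vectors (num_cycles I)" and j: "j \<in> cycles" "j' \<in> cycles"
  shows "P_pair I cyc w (d j) (d j') j j' =
    (\<Sum>i\<in>between_contacts I cyc j j'. arc_weight I (choice cycles d) i)"
  unfolding P_pair_def
proof (rule sum.cong[OF refl])
  fix i assume i: "i \<in> between_contacts I cyc j j'"
  note d' = bool_vectors_funcset[OF d]
  have eq: "special_edges (bip_graph I) \<union> w (d j) j \<union> w (d j') j' = choice {j, j'} d"
    by (auto simp: choice_def)
  have "partner (choice {j, j'} d) p = partner (choice cycles d) p"
    if "Inl p \<in> fst (cyc j) \<or> Inl p \<in> fst (cyc j')" for p
    by (rule partner_choice_cong) (use that j d' in auto)
  moreover have "\<forall>p\<in>{i, cyc_suc (num I) i}. Inl p \<in> fst (cyc j) \<or> Inl p \<in> fst (cyc j')"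
    using i by (auto simp: between_contacts_def)
  ultimately show "arc_weight I (special_edges (bip_graph I) \<union> w (d j) j \<union> w (d j') j') i =
      arc_weight I (choice cycles d) i"
    unfolding eq arc_weight_def by simp
qed

text \<open>The two ends of a contact between different cycles are matched into different cycles, hence
  to different vertices. So no loop weight, which may be negative, occurs.\<close>

lemma P_pair_nonneg:
  assumes j: "j \<in> cycles" "j' \<in> cycles" "j \<noteq> j'" and kl: "k \<in> {0, 1}" "l \<in> {0, 1}"
  shows "P_pair I cyc w k l j j' \<ge> 0"
  unfolding P_pair_def
proof (rule sum_nonneg)
  fix i assume i: "i \<in> between_contacts I cyc j j'"
  \<comment> \<open>The indices \<open>k\<close> and \<open>l\<close> come from no given vector, so
    a local choice is built from them; it is consistent because
    \<open>j \<noteq> j'\<close>.\<close>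
  define d where "d x = (if x = j then k else l)" for x
  define M where "M = special_edges (bip_graph I) \<union> w k j \<union> w l j'"
  have M: "M = choice {j, j'} d"
    using j by (auto simp: choice_def M_def d_def)
  have pair: "partner M p \<in> verts I \<and> Inr (partner M p) \<in> fst (cyc x)"
    if "x \<in> {j, j'}" "Inl p \<in> fst (cyc x)" for p x
  proof -
    have x: "x \<in> cycles" "d x \<in> {0, 1}"
      using that j kl by (auto simp: d_def)
    have "partner M p = partner (w (d x) x) p"
      unfolding M by (rule partner_choice_cycle) (use that j kl in \<open>auto simp: d_def\<close>)
    then have in_cyc: "Inr (partner M p) \<in> fst (cyc x)"
      using component_partner_in_req(3)[OF inst cyc_component[OF x(1)] w_perfect[OF x] that(2)] by simp
    then have "Inr (partner M p) \<in> fst (bip_graph I)"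
      by (rule cyc_vertices(1)[OF x(1)])
    then show ?thesis
      using in_cyc by (auto simp: bip_graph_def)
  qed
  let ?s = "cyc_suc (num I) i"
  \<comment> \<open>The contact may run in either direction; \<open>x\<close> and \<open>y\<close>
    name the two cycles in the order of the tour.\<close>
  obtain x y where xy: "x \<in> {j, j'}" "y \<in> {j, j'}" "x \<noteq> y" "Inl i \<in> fst (cyc x)" "Inl ?s \<in> fst (cyc y)"
    using i j(3) by (auto simp: between_contacts_def)
  have cycles: "x \<in> cycles" "y \<in> cycles"
    using xy(1,2) j(1,2) by blast+
  have "partner M i \<noteq> partner M ?s"
    using pair[OF xy(1,4)] pair[OF xy(2,5)] cyc_unique[OF cycles] xy(3) by metis
  then have "wt I (partner M i) (partner M ?s) \<ge> 0"
    using pair[OF xy(1,4)] pair[OF xy(2,5)] inst by (simp add: two_tspvr_def)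
  then show "arc_weight I (special_edges (bip_graph I) \<union> w k j \<union> w l j') i \<ge> 0"
    by (simp add: arc_weight_def M_def)
qed

text \<open>The closing arc is the term \<open>i = num I\<close>. For \<open>num I = 0\<close> the
  cost would still contain such an arc while the sum is empty.\<close>

lemma tour_cost_cyclic:
  assumes "num I \<ge> 1"
  shows "tour_cost I f = (\<Sum>i\<in>positions. wt I (f i) (f (cyc_suc (num I) i)))"
proof -
  have "positions = insert (num I) {1..num I - 1}"
    using assms by auto
  moreover have "num I \<notin> {1..num I - 1}"
    using assms by auto
  moreover have "(\<Sum>i=1..num I - 1. wt I (f i) (f (cyc_suc (num I) i))) = (\<Sum>i=1..num I - 1. wt I (f i) (f (i + 1)))"
    by (rule sum.cong) (use assms in \<open>auto simp: cyc_suc_def\<close>)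
  ultimately show ?thesis
    by (simp add: tour_cost_def cyc_suc_def[of _ "num I"])
qed

end

text \<open>The indices are sorted by the unordered pair of their labels: both 0, a single nonzero
  label \<open>j\<close>, or two nonzero labels \<open>j < j'\<close>. These classes give the
  constant, the linear and the quadratic part of (Q).\<close>

lemma sum_by_index_pair:
  fixes h :: "nat \<Rightarrow> real"
  assumes A: "finite A" and ab: "\<And>i. i \<in> A \<Longrightarrow> a i \<le> q \<and> b i \<le> q"
  shows "sum h A = sum h {i \<in> A. a i = 0 \<and> b i = (0::nat)}
    + (\<Sum>j=1..q. sum h {i \<in> A. a i = j \<and> b i = j \<or> a i = j \<and> b i = 0 \<or> a i = 0 \<and> b i = j})
    + (\<Sum>j=1..q-1. \<Sum>j'=j+1..q. sum h {i \<in> A. a i = j \<and> b i = j' \<or> a i = j' \<and> b i = j})"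
proof -
  define Z where "Z = {i \<in> A. a i = 0 \<and> b i = 0}"
  define S where "S j = {i \<in> A. a i = j \<and> b i = j \<or> a i = j \<and> b i = 0 \<or> a i = 0 \<and> b i = j}" for j
  define B where "B = (\<lambda>(j, j'). {i \<in> A. a i = j \<and> b i = j' \<or> a i = j' \<and> b i = j})"
  let ?T = "Sigma {1..q-1} (\<lambda>j. {j+1..q})"
  have split: "A = Z \<union> (\<Union>j\<in>{1..q}. S j) \<union> (\<Union>t\<in>?T. B t)"
  proof (intro set_eqI iffI)
    fix i assume i: "i \<in> A"
    consider "a i = 0 \<and> b i = 0" | "a i = 0 \<and> b i \<in> {1..q}" | "b i = 0 \<and> a i \<in> {1..q}"
      | "a i = b i \<and> a i \<in> {1..q}"
      | "(a i, b i) \<in> ?T" | "(b i, a i) \<in> ?T"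
      using ab[OF i] by fastforce
    then show "i \<in> Z \<union> (\<Union>j\<in>{1..q}. S j) \<union> (\<Union>t\<in>?T. B t)"
    proof cases
      case 1 then show ?thesis using i by (simp add: Z_def)
    next
      case 2 then have "i \<in> S (b i)" using i by (simp add: S_def)
      then show ?thesis using 2 by blast
    next
      case 3 then have "i \<in> S (a i)" using i by (simp add: S_def)
      then show ?thesis using 3 by blast
    next
      case 4 then have "i \<in> S (a i)" using i by (simp add: S_def)
      then show ?thesis using 4 by blast
    next
      case 5 have "i \<in> B (a i, b i)" using i by (simp add: B_def)
      then show ?thesis using 5 by blast
    next
      case 6 have "i \<in> B (b i, a i)" using i by (simp add: B_def)
      then show ?thesis using 6 by blast
    qed
  qed (auto simp: Z_def S_def B_def)
  have fin: "finite Z" "finite (S j)" "finite (B t)" for j t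
    using A by (auto simp: Z_def S_def B_def split: prod.split)
  have "sum h A = sum h (Z \<union> (\<Union>j\<in>{1..q}. S j)) + sum h (\<Union>t\<in>?T. B t)"
    by (subst split, rule sum.union_disjoint) (use fin in \<open>auto simp: Z_def S_def B_def\<close>)
  also have "sum h (Z \<union> (\<Union>j\<in>{1..q}. S j)) = sum h Z + sum h (\<Union>j\<in>{1..q}. S j)"
    by (rule sum.union_disjoint) (use fin in \<open>auto simp: Z_def S_def\<close>)
  also have "sum h (\<Union>j\<in>{1..q}. S j) = (\<Sum>j=1..q. sum h (S j))"
    by (rule sum.UNION_disjoint) (use fin in \<open>auto simp: S_def\<close>)
  also have "sum h (\<Union>t\<in>?T. B t) = (\<Sum>t\<in>?T. sum h (B t))"
    by (rule sum.UNION_disjoint) (use fin in \<open>auto simp: B_def\<close>)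
  also have "\<dots> = (\<Sum>j=1..q-1. \<Sum>j'=j+1..q. sum h (B (j, j')))"
    by (subst sum.Sigma) auto
  finally show ?thesis
    by (simp only: Z_def S_def B_def prod.case)
qed

section \<open>Tour cost, optimal solutions and the number of cycles\<close>

context labelled_tspvr
begin

lemma tour_cost_sol_of:
  assumes n: "num I \<ge> 1"
  shows "\<exists>K. \<forall>d\<in>bool_vectors (num_cycles I).
    tour_cost I (sol_of I w d) = K + Q_obj (num_cycles I) (P_single I cyc w) (P_pair I cyc w) d"
proof (intro exI ballI)
  define b where "b i = cycle_index (cyc_suc (num I) i)" for i
  define Z where "Z = {i \<in> positions. cycle_index i = 0 \<and> b i = 0}"
  \<comment> \<open>Fixed before \<open>d\<close>: both ends of these arcs are determined by special
    edges alone.\<close>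
  let ?K = "\<Sum>i\<in>Z. arc_weight I (special_edges (bip_graph I)) i"
  fix d assume d: "d \<in> bool_vectors (num_cycles I)"
  note d' = bool_vectors_funcset[OF d]
  let ?h = "arc_weight I (choice cycles d)"
  have "tour_cost I (sol_of I w d) = sum ?h positions"
    unfolding tour_cost_cyclic[OF n] sol_of_choice
  proof (rule sum.cong[OF refl])
    fix i assume i: "i \<in> positions"
    show "wt I (restrict (partner (choice cycles d)) positions i)
        (restrict (partner (choice cycles d)) positions (cyc_suc (num I) i)) = ?h i"
      using i cyc_suc_position[OF i] by (simp add: arc_weight_def)
  qed
  also have "\<dots> = sum ?h Z
    + (\<Sum>j\<in>cycles. sum ?h (inside_contacts I cyc j \<union> special_contacts I cyc j))
    + (\<Sum>j=1..num_cycles I - 1. \<Sum>j'=j+1..num_cycles I. sum ?h (between_contacts I cyc j j'))"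
  proof -
    have "cycle_index i \<le> num_cycles I \<and> b i \<le> num_cycles I" if "i \<in> positions" for i
      using cycle_index_iff(3) cyc_suc_position that unfolding b_def by blast
    then have "sum ?h positions = sum ?h Z
      + (\<Sum>j\<in>cycles. sum ?h {i \<in> positions. cycle_index i = j \<and> b i = j \<or> cycle_index i = j \<and> b i = 0 \<or>
            cycle_index i = 0 \<and> b i = j})
      + (\<Sum>j=1..num_cycles I - 1. \<Sum>j'=j+1..num_cycles I.
            sum ?h {i \<in> positions. cycle_index i = j \<and> b i = j' \<or> cycle_index i = j' \<and> b i = j})"
      unfolding Z_def by (intro sum_by_index_pair) auto
    then show ?thesis
      by (simp add: single_contacts_eq between_contacts_eq Let_def b_def)
  qed
  also have "sum ?h Z = ?K"
  proof (rule sum.cong[OF refl])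
    fix i assume "i \<in> Z"
    then have i: "i \<in> positions" "Inl i \<in> specials" "Inl (cyc_suc (num I) i) \<in> specials"
      using cycle_index_iff(1) cyc_suc_position unfolding Z_def b_def by blast+
    show "?h i = arc_weight I (special_edges (bip_graph I)) i"
      unfolding arc_weight_def i(2,3)[THEN partner_choice_special[OF order_refl d']] ..
  qed
  also have "(\<Sum>j\<in>cycles. sum ?h (inside_contacts I cyc j \<union> special_contacts I cyc j)) =
      (\<Sum>j\<in>cycles. P_single I cyc w (d j) j)"
    by (intro sum.cong[OF refl] P_single_eq[OF d, symmetric])
  also have "(\<Sum>j=1..num_cycles I - 1. \<Sum>j'=j+1..num_cycles I. sum ?h (between_contacts I cyc j j')) =
      (\<Sum>j=1..num_cycles I - 1. \<Sum>j'=j+1..num_cycles I. P_pair I cyc w (d j) (d j') j j')"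
    by (intro sum.cong[OF refl] P_pair_eq[OF d, symmetric]) auto
  finally show "tour_cost I (sol_of I w d) = ?K + Q_obj (num_cycles I) (P_single I cyc w) (P_pair I cyc w) d"
    unfolding Q_obj_bool[OF d] by simp
qed

text \<open>A constant shift preserves minimizers, and \<open>sol_of I w\<close> maps the Boolean
  vectors onto all solutions.\<close>

lemma Q_optimal_iff_tour_optimal:
  assumes n: "num I \<ge> 1" and d: "d \<in> bool_vectors (num_cycles I)"
  shows "is_arg_min (Q_obj (num_cycles I) (P_single I cyc w) (P_pair I cyc w))
      (\<lambda>d. d \<in> bool_vectors (num_cycles I)) d \<longleftrightarrow>
    is_arg_min (tour_cost I) (\<lambda>f. f \<in> solutions I) (sol_of I w d)"
proof -
  let ?Q = "Q_obj (num_cycles I) (P_single I cyc w) (P_pair I cyc w)"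
  obtain K where K: "\<And>d. d \<in> bool_vectors (num_cycles I) \<Longrightarrow> tour_cost I (sol_of I w d) = K + ?Q d"
    using tour_cost_sol_of[OF n] by blast
  have "solutions I = sol_of I w ` bool_vectors (num_cycles I)"
    using sol_of_solution solution_is_sol_of by blast
  then show ?thesis
    using d K by (simp add: is_arg_min_def Ball_def)
qed

text \<open>The cycles occupy disjoint sets of positions, each with at least two elements.\<close>

lemma num_cycles_le: "num_cycles I \<le> num I div 2"
proof -
  define A where "A j = {i. Inl i \<in> fst (cyc j)}" for j
  have sub: "A j \<subseteq> positions" if "j \<in> cycles" for j
    using cyc_vertices(1)[OF that] position_vertex unfolding A_def by blast
  have "2 * num_cycles I = (\<Sum>j\<in>cycles. 2)"
    by simp
  also have "\<dots> \<le> (\<Sum>j\<in>cycles. card (A j))"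
    unfolding A_def
    by (intro sum_mono component_two_positions[OF inst cyc_component w_perfect w_perfect w_distinct]) auto
  also have "\<dots> = card (\<Union>j\<in>cycles. A j)"
  proof (rule card_UN_disjoint[symmetric])
    show "\<forall>j\<in>cycles. finite (A j)"
      using sub finite_subset by blast
    show "\<forall>j\<in>cycles. \<forall>j'\<in>cycles. j \<noteq> j' \<longrightarrow> A j \<inter> A j' = {}"
      using cyc_unique unfolding A_def by blast
  qed simp
  also have "\<dots> \<le> card positions"
    by (rule card_mono) (use sub in blast)+
  finally show ?thesis by simp
qed

end

theorem mainTheorem4:
  fixes I :: "'a tspvr"
    and cyc :: "nat \<Rightarrow> (nat + 'a) graph"
    and w :: "nat \<Rightarrow> nat \<Rightarrow> (nat + 'a) set set"
  assumes "two_tspvr I" and "num I \<ge> 2" and "feasible I" and "cycle_labelling I cyc w"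
  shows
    "(let q = num_cycles I;
          P = P_single I cyc w;
          PP = P_pair I cyc w;
          Q_opt = is_arg_min (Q_obj q P PP) (\<lambda>d. d \<in> bool_vectors q);
          M = M_prog q P PP;
          M_opt = is_arg_min (objective M) (mip_feasible M)
      in mixed_integer_linear M
       \<and> (\<exists>v. optimal_value (Q_obj q P PP) (\<lambda>d. d \<in> bool_vectors q) v
            \<and> optimal_value (objective M) (mip_feasible M) v)
       \<and> (\<forall>d p. M_opt (d, p) \<longrightarrow> Q_opt d)
       \<and> (\<forall>d. Q_opt d \<longrightarrow> (\<exists>p. M_opt (d, p)))
       \<and> (\<forall>d\<in>bool_vectors q.
            Q_opt d \<longleftrightarrow> is_arg_min (tour_cost I) (\<lambda>f. f \<in> solutions I) (sol_of I w d))
       \<and> card (bool_vars M) = q \<and> q \<le> num I div 2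
       \<and> (q \<ge> 1 \<longrightarrow> card (real_vars M) = 2 * q - 2))
     \<and> (\<exists>C::nat. \<forall>q P PP. length (constraints (M_prog q P PP)) \<le> C * q)"
proof -
  interpret labelled_tspvr I cyc w
    by unfold_locales fact+
  \<comment> \<open>The range of \<open>j'\<close> forces \<open>j < j'\<close>, so the two cycles
    are different.\<close>
  have nonneg: "P_pair I cyc w k l j j' \<ge> 0"
    if "k \<in> {0, 1}" "l \<in> {0, 1}" "j \<in> cycles" "j' \<in> {j+1..num_cycles I}" for k l j j'
    using P_pair_nonneg[of j j' k l] that by auto
  note equiv = Q_M_equivalent[where P = "P_single I cyc w", OF nonneg]
  have vars: "card (bool_vars (M_prog q P PP)) = q" "card (real_vars (M_prog q P PP)) = 2 * (q - 1)" for q P PP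
    by (simp_all add: M_prog_def card_cartesian_product)
  have "\<exists>C::nat. \<forall>q P PP. length (constraints (M_prog q P PP)) \<le> C * q"
    using M_prog_length_constraints by blast
  then show ?thesis
    unfolding Let_def
    using M_prog_linear equiv Q_optimal_iff_tour_optimal num_cycles_le vars assms(2)
    by (simp add: diff_mult_distrib2)
qed

end
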